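(* For an odd prime $N$, let $\beta$ be a random element chosen uniformly from the (finite) set of binary elements of $O=\mathbb{Z}[e^{2\pi i/N}]$, and let $S=\log\mathcal{N}(\beta)$. Then as $N\to\infty$, $$\mathrm{E}(S)=\frac12\left(\log(N/4)-\gamma\right)N$$ asymptotically, where $\gamma=0.577215\ldots$ is Euler's constant.
   Context: Let $\zeta=e^{2\pi i/N}$. Elements of $O=\mathbb{Z}[\zeta]$ are written in the basis $\zeta,\dots,\zeta^{N-1}$ as $\alpha=\sum_{i=1}^{N-1}[\alpha]_i\zeta^i$. An element $\beta\in O$ is binary if $\beta\ne0$ and either all coordinates $[\beta]_i$ lie in $\{0,1\}$ or all lie in $\{-1,0\}$ (there are $2^N-2$ binary elements). With $\sigma_j$ the automorphism $\zeta\mapsto\zeta^j$, the norm is $\mathcal{N}(\alpha)=\prod_{j=1}^{N-1}\sigma_j(\alpha)=\prod_{j=1}^{(N-1)/2}|\sigma_j(\alpha)|^2$, which is a positive integer for $\alpha\neq0$. *)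

theory Defs
  imports
    "HOL-Probability.Probability"
    "HOL-Computational_Algebra.Computational_Algebra"
begin

definition zeta :: "nat \<Rightarrow> complex" where
  "zeta N = exp (2 * of_real pi * \<i> / of_nat N)"

definition cyclotomic_ring :: "nat \<Rightarrow> complex set" where
  "cyclotomic_ring N = range (\<lambda>p :: int poly. poly (map_poly of_int p) (zeta N))"

text \<open>For \<open>N\<close> prime, \<open>zeta N ^ 1, \<dots>, zeta N ^ (N - 1)\<close> is an integral basis of the ring, so the
  description below determines the coordinate function; it is padded with zeros outside
  \<open>{1..N - 1}\<close>.\<close>

definition coords :: "nat \<Rightarrow> complex \<Rightarrow> nat \<Rightarrow> int" where
  "coords N \<alpha> = (THE c. (\<forall>i. i \<notin> {1..N - 1} \<longrightarrow> c i = 0) \<and>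
     \<alpha> = (\<Sum>i = 1..N - 1. of_int (c i) * zeta N ^ i))"

definition binary_elements :: "nat \<Rightarrow> complex set" where
  "binary_elements N = {\<beta> \<in> cyclotomic_ring N. \<beta> \<noteq> 0 \<and>
     ((\<forall>i\<in>{1..N - 1}. coords N \<beta> i \<in> {0, 1}) \<or>
      (\<forall>i\<in>{1..N - 1}. coords N \<beta> i \<in> {-1, 0}))}"

definition ring_automorphism :: "complex set \<Rightarrow> (complex \<Rightarrow> complex) \<Rightarrow> bool" where
  "ring_automorphism R \<sigma> \<longleftrightarrow> bij_betw \<sigma> R R \<and> \<sigma> 1 = 1 \<and>
     (\<forall>x\<in>R. \<forall>y\<in>R. \<sigma> (x + y) = \<sigma> x + \<sigma> y \<and> \<sigma> (x * y) = \<sigma> x * \<sigma> y)"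

text \<open>An automorphism is determined on \<open>cyclotomic_ring N\<close> by its value at \<open>zeta N\<close>, so the
  choice only affects arguments outside the ring.\<close>

definition conj_aut :: "nat \<Rightarrow> nat \<Rightarrow> complex \<Rightarrow> complex" where
  "conj_aut N j = (SOME \<sigma>. ring_automorphism (cyclotomic_ring N) \<sigma> \<and> \<sigma> (zeta N) = zeta N ^ j)"

definition cyclotomic_norm :: "nat \<Rightarrow> complex \<Rightarrow> complex" where
  "cyclotomic_norm N \<alpha> = (\<Prod>j = 1..N - 1. conj_aut N j \<alpha>)"

text \<open>For \<open>N\<close> an odd prime the norm of a nonzero element is a positive integer, so taking the
  real part only changes the type.\<close>

definition log_norm :: "nat \<Rightarrow> complex \<Rightarrow> real" where
  "log_norm N \<beta> = ln (Re (cyclotomic_norm N \<beta>))"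

definition expected_log_norm :: "nat \<Rightarrow> real" where
  "expected_log_norm N =
     measure_pmf.expectation (pmf_of_set (binary_elements N)) (log_norm N)"

end

theory Submission
  imports Defs "HOL-Real_Asymp.Real_Asymp" "HOL-Number_Theory.Cong"
begin

text \<open>
  The automorphisms permute the powers of \<open>zeta N\<close>, so the expectation of \<open>log_norm N\<close> is
  \<open>N - 1\<close> times the mean of \<open>ln |X|\<close> over the nonempty subset sums \<open>X = (\<Sum>i\<in>A. zeta N ^ i)\<close>.
  With \<open>Y = 4 |X|\<^sup>2 / N\<close>, Frullani's formula writes \<open>ln Y\<close> as the integral of
  \<open>(exp (- t) - exp (- t Y)) / t\<close>. The Laplace transform of \<open>Y\<close> is a Gaussian average of the
  characteristic function of the random vector \<open>X\<close>, a product of cosines; it converges to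
  \<open>1 / (1 + t)\<close> (so \<open>Y\<close> is asymptotically exponential), and the limiting integral is
  \<open>- euler_mascheroni\<close>. Uniform integrability splits at \<open>t = N\<^sup>2\<close>. Below it, equidistribution of the
  roots of unity bounds the characteristic function and gives a Laplace transform of order
  \<open>1 / (1 + t)\<close>. Above it, the fact that \<open>N - 1\<close> times the norm is a nonzero integer forces
  \<open>|X| \<ge> N ^ (- N)\<close>, hence \<open>|ln Y|\<close> of order \<open>N ln N\<close>, which is beaten by the probability of order
  \<open>N ^ (- 2)\<close> of such a small value.
\<close>

section \<open>Frullani integrals and the Euler--Mascheroni constant\<close>

text \<open>The main term has order \<open>N * ln N\<close>, so a ratio asymptotic could not see the
  constant: it takes an absolute error o(N), hence convergence of the mean of \<open>ln Y\<close>
  itself. Convergence in law does not give that, because the logarithm is unbounded at 0 and the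
  arithmetic lower bound for \<open>Y\<close> is extremely weak. The cutoff \<open>N^2\<close>
  balances two demands. It must exceed \<open>N * ln N\<close> by a growing factor, so that a
  Laplace transform of order \<open>1 / t\<close> at the cutoff outweighs a logarithm of order
  \<open>N * ln N\<close>. It must also keep the Gaussian argument of the characteristic function,
  of typical size \<open>sqrt (2 * t)\<close>, well inside radius about
  \<open>N powr (3 / 2)\<close>, where the decay estimate from \<open>N\<close> equally spaced
  samples applies; beyond that radius only the bound 1 is used, paid for by a Gaussian tail
  exponentially small in \<open>N\<close>. The integer \<open>(N - 1) * norm\<close> arises by
  summing one polynomial over all \<open>N\<close>-th roots of unity, and the same identity modulo
  \<open>N\<close> drives the proof that the powers of \<open>zeta N\<close> are
  independent.\<close>

lemma frullani_inner_integral: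
  fixes a b t :: real
  assumes "a \<le> b" "t \<noteq> 0"
  shows "integral {a..b} (\<lambda>s. exp (- t * s)) = (exp (- t * a) - exp (- t * b)) / t"
proof -
  have "((\<lambda>s. exp (- t * s)) has_integral (- exp (- t * b) / t - (- exp (- t * a) / t))) {a..b}"
    using assms
    by (intro fundamental_theorem_of_calculus)
       (auto intro!: derivative_eq_intros simp: has_real_derivative_iff_has_vector_derivative[symmetric])
  thus ?thesis
    by (simp add: integral_unique diff_divide_distrib)
qed

lemma frullani_has_integral:
  fixes a b T :: real
  assumes "a \<le> b"
  shows "((\<lambda>t. (exp (- t * a) - exp (- t * b)) / t) has_integral
    integral {0..T} (\<lambda>t. integral {a..b} (\<lambda>s. exp (- t * s)))) {0..T}"
proof -
  have "continuous_on {0..T} (\<lambda>t. integral (cbox a b) (\<lambda>s. exp (- t * s)))"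
    by (rule integral_continuous_on_param) (unfold split_beta, intro continuous_intros)
  hence "((\<lambda>t. integral {a..b} (\<lambda>s. exp (- t * s))) has_integral
      integral {0..T} (\<lambda>t. integral {a..b} (\<lambda>s. exp (- t * s)))) {0..T}"
    using integrable_continuous_interval integrable_integral by (metis box_real(2))
  \<comment> \<open>At \<open>t = 0\<close> the quotient is 0 by the convention for division,
    whereas the inner integral is \<open>b - a\<close>; the discrepancy sits on a null set.\<close>
  thus ?thesis
    by (rule has_integral_spike[OF negligible_sing[of 0], rotated])
       (use frullani_inner_integral[OF assms] in auto)
qed

lemma frullani_integrable:
  fixes a b T :: real
  shows "(\<lambda>t. (exp (- t * a) - exp (- t * b)) / t) integrable_on {0..T}"
proof (cases "a \<le> b")
  case True
  thus ?thesis using frullani_has_integral by blast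
next
  case False
  hence "(\<lambda>t. - ((exp (- t * b) - exp (- t * a)) / t)) integrable_on {0..T}"
    using frullani_has_integral[of b a T] by (intro integrable_neg) auto
  thus ?thesis by (simp add: minus_divide_left)
qed

text \<open>Write the integrand as the integral of \<open>exp (- t * s)\<close> over
  \<open>s\<close> in \<open>{a..b}\<close> and swap: the \<open>t\<close>-integral up to
  \<open>T\<close> is \<open>(1 - exp (- T * s)) / s\<close>. Its first part yields the logarithms,
  its second the truncation error \<open>R\<close>.\<close>

lemma frullani_truncated_aux:
  fixes a b T :: real
  assumes "0 < a" "a \<le> b" "0 \<le> T"
  shows "\<exists>R. 0 \<le> R \<and> R \<le> exp (- T * a) * (ln b - ln a) \<and>
    ((\<lambda>t. (exp (- t * a) - exp (- t * b)) / t) has_integral (ln b - ln a - R)) {0..T}"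
proof -
  define f where "f = (\<lambda>t s :: real. exp (- t * s))"
  define R where "R = integral {a..b} (\<lambda>s. exp (- T * s) / s)"
  have cont: "continuous_on {a..b} (\<lambda>s. exp (- T * s) / s)"
    using assms by (intro continuous_intros) auto
  have R: "((\<lambda>s. exp (- T * s) / s) has_integral R) {a..b}"
    unfolding R_def using cont integrable_continuous_interval by blast
  have ln: "((\<lambda>s. 1 / s) has_integral (ln b - ln a)) {a..b}"
    using assms
    by (intro fundamental_theorem_of_calculus)
       (auto intro!: derivative_eq_intros simp: has_real_derivative_iff_has_vector_derivative[symmetric])
  have "0 \<le> R"
    by (rule has_integral_nonneg[OF R]) (use assms in auto)
  moreover have "R \<le> exp (- T * a) * (ln b - ln a)"
  proof (rule has_integral_le[OF R has_integral_mult_right[OF ln]])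
    fix s assume "s \<in> {a..b}"
    thus "exp (- T * s) / s \<le> exp (- T * a) * (1 / s)"
      using assms by (auto intro!: divide_right_mono mult_left_mono)
  qed
  moreover have "((\<lambda>t. (exp (- t * a) - exp (- t * b)) / t) has_integral (ln b - ln a - R)) {0..T}"
  proof -
    have inner2: "integral {0..T} (\<lambda>t. f t s) = 1 / s - exp (- T * s) / s" if "s \<in> {a..b}" for s
    proof -
      have "((\<lambda>t. f t s) has_integral (- exp (- T * s) / s - (- exp (- 0 * s) / s))) {0..T}"
        unfolding f_def using assms that
        by (intro fundamental_theorem_of_calculus)
           (auto intro!: derivative_eq_intros simp: has_real_derivative_iff_has_vector_derivative[symmetric])
      thus ?thesis
        by (simp add: integral_unique)
    qed
    have contf: "continuous_on (cbox (0, a) (T, b)) (\<lambda>(t, s). f t s)"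
      unfolding f_def split_beta by (intro continuous_intros)
    have "integral {0..T} (\<lambda>t. integral {a..b} (f t)) = integral {a..b} (\<lambda>s. integral {0..T} (\<lambda>t. f t s))"
      using integral_swap_continuous[OF contf] by simp
    also have "\<dots> = integral {a..b} (\<lambda>s. 1 / s - exp (- T * s) / s)"
      by (intro integral_cong inner2)
    also have "\<dots> = ln b - ln a - R"
      using has_integral_diff[OF ln R] by (rule integral_unique)
    finally have eq: "integral {0..T} (\<lambda>t. integral {a..b} (f t)) = ln b - ln a - R" .
    show ?thesis
      using frullani_has_integral[OF assms(2), of T] eq unfolding f_def by simp
  qed
  ultimately show ?thesis by blast
qed

text \<open>The error decays at the rate of the smaller endpoint, hence \<open>min 1 y\<close>: for
  \<open>y\<close> far below \<open>1 / T\<close> the cutoff gains nothing, which is why very small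
  subset sums need a separate bound.\<close>

lemma frullani_truncated:
  fixes y T :: real
  assumes "0 < y" "0 \<le> T"
  obtains h where "((\<lambda>t. (exp (- t) - exp (- t * y)) / t) has_integral h) {0..T}"
    and "\<bar>h - ln y\<bar> \<le> exp (- T * min 1 y) * \<bar>ln y\<bar>"
proof (cases "1 \<le> y")
  case True
  from frullani_truncated_aux[of 1 y T] True assms obtain R where
    "0 \<le> R" "R \<le> exp (- T) * ln y" "((\<lambda>t. (exp (- t) - exp (- t * y)) / t) has_integral (ln y - R)) {0..T}"
    by auto
  thus ?thesis using True by (intro that) auto
next
  case False
  from frullani_truncated_aux[of y 1 T] False assms obtain R where R:
    "0 \<le> R" "R \<le> exp (- T * y) * (- ln y)" "((\<lambda>t. (exp (- t * y) - exp (- t)) / t) has_integral (- ln y - R)) {0..T}"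
    by auto
  have "((\<lambda>t. (exp (- t) - exp (- t * y)) / t) has_integral (ln y + R)) {0..T}"
    using has_integral_neg[OF R(3)] by (simp add: minus_divide_left add.commute)
  thus ?thesis using False R(1,2) assms by (intro that) auto
qed

text \<open>The common majorant in both uses of dominated convergence, here for Euler's constant and
  later for \<open>laplace_gap\<close>.\<close>

lemma integrable_on_inverse_1_plus_square:
  "(\<lambda>t::real. c / (1 + t\<^sup>2)) integrable_on {0..}"
proof -
  have "set_integrable lborel UNIV (\<lambda>x::real. inverse (1 + x\<^sup>2))"
    using integrable_inverse_1_plus_square by simp
  hence "set_integrable lborel {0..} (\<lambda>x::real. inverse (1 + x\<^sup>2))"
    by (rule set_integrable_subset) auto
  hence "(\<lambda>x::real. inverse (1 + x\<^sup>2)) integrable_on {0..}"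
    using set_borel_integral_eq_integral(1) by blast
  from integrable_on_mult_right[OF this, of c] show ?thesis
    by (simp add: divide_inverse)
qed

text \<open>With \<open>x = 1 - t / n\<close> this is the classical integral of
  \<open>(1 - x ^ n) / (1 - x)\<close> over the unit interval, a finite geometric sum integrated
  term by term.\<close>

lemma harm_integral:
  assumes "n > 0"
  shows "((\<lambda>t. (1 - (1 - t / real n) ^ n) / t) has_integral harm n) {0..real n}"
proof -
  have "((\<lambda>t. (1 - t / real n) ^ k / real n) has_integral inverse (real (Suc k))) {0..real n}" for k
  proof -
    have "((\<lambda>t. (1 - t / real n) ^ k / real n) has_integral
        (- ((1 - real n / real n) ^ Suc k / real (Suc k)) - (- ((1 - 0 / real n) ^ Suc k / real (Suc k))))) {0..real n}"
      using assms
      by (intro fundamental_theorem_of_calculus)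
         (auto intro!: derivative_eq_intros simp: has_real_derivative_iff_has_vector_derivative[symmetric]
           simp del: of_nat_Suc power_Suc)
    thus ?thesis using assms by (simp add: field_simps)
  qed
  hence "((\<lambda>t. \<Sum>k<n. (1 - t / real n) ^ k / real n) has_integral (\<Sum>k<n. inverse (real (Suc k)))) {0..real n}"
    by (intro has_integral_sum) auto
  hence "((\<lambda>t. \<Sum>k<n. (1 - t / real n) ^ k / real n) has_integral harm n) {0..real n}"
    by (simp add: harm_altdef)
  thus ?thesis
  proof (rule has_integral_spike[OF negligible_sing[of 0], rotated])
    fix t assume "t \<in> {0..real n} - {0}"
    thus "(1 - (1 - t / real n) ^ n) / t = (\<Sum>k<n. (1 - t / real n) ^ k / real n)"
      using one_diff_power_eq[of "1 - t / real n" n] assms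
      by (simp add: sum_divide_distrib[symmetric])
  qed
qed

text \<open>Replacing \<open>exp (- t)\<close> by \<open>(1 - t / m) ^ m\<close> on
  \<open>{0..m}\<close> makes the integral exactly \<open>ln (m + 1) - harm m\<close>; dominated
  convergence does the rest.\<close>

lemma euler_mascheroni_integral:
  "((\<lambda>t. (exp (- t) - 1 / (1 + t)) / t) has_integral (- euler_mascheroni :: real)) {0..}"
proof -
  define f where "f = (\<lambda>n t. if t \<in> {0..real (Suc n)}
      then ((1 - t / real (Suc n)) ^ Suc n - 1 / (1 + t)) / t else 0)"
  have I: "(f n has_integral (ln (real (Suc n) + 1) - harm (Suc n))) {0..}" for n
  proof -
    let ?m = "real (Suc n)"
    have "((\<lambda>t. 1 / (1 + t)) has_integral (ln (1 + ?m) - ln (1 + 0))) {0..?m}"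
      by (intro fundamental_theorem_of_calculus)
         (auto intro!: derivative_eq_intros simp: has_real_derivative_iff_has_vector_derivative[symmetric])
    from has_integral_diff[OF this harm_integral[of "Suc n"]]
    have "((\<lambda>t. 1 / (1 + t) - (1 - (1 - t / ?m) ^ Suc n) / t) has_integral
        (ln (?m + 1) - harm (Suc n))) {0..?m}" by (simp add: add_ac)
    hence "((\<lambda>t. ((1 - t / ?m) ^ Suc n - 1 / (1 + t)) / t) has_integral
        (ln (?m + 1) - harm (Suc n))) {0..?m}"
    proof (rule has_integral_spike[OF negligible_sing[of 0], rotated])
      fix t assume t: "t \<in> {0..?m} - {0}"
      hence "1 / (1 + t) = (1 - 1 / (1 + t)) / t" by (simp add: divide_simps)
      moreover have "((1 - t / ?m) ^ Suc n - 1 / (1 + t)) / t = (1 - 1 / (1 + t)) / t - (1 - (1 - t / ?m) ^ Suc n) / t"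
        unfolding diff_divide_distrib by linarith
      ultimately show "((1 - t / ?m) ^ Suc n - 1 / (1 + t)) / t = 1 / (1 + t) - (1 - (1 - t / ?m) ^ Suc n) / t"
        by argo
    qed
    thus ?thesis
      unfolding f_def by (subst has_integral_restrict) auto
  qed
  show ?thesis
  proof (rule has_integral_dominated_convergence[OF I integrable_on_inverse_1_plus_square[of 2]])
    fix n
    show "\<forall>t\<in>{0..}. norm (f n t) \<le> 2 / (1 + t\<^sup>2)"
    proof
      fix t :: real assume t: "t \<in> {0..}"
      let ?m = "real (Suc n)"
      show "norm (f n t) \<le> 2 / (1 + t\<^sup>2)"
      proof (cases "t \<in> {0<..?m}")
        case True
        have nn: "0 \<le> (1 - t / ?m) ^ Suc n"
          using True by (intro zero_le_power) (simp add: field_simps)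
        \<comment> \<open>Bernoulli's inequality makes the numerator of order \<open>t^2\<close>
          near 0, so the quotient stays bounded there. The bound \<open>nn\<close> serves for large
          \<open>t\<close>, and \<open>hi\<close> fixes the sign.\<close>
        have lo: "1 - t \<le> (1 - t / ?m) ^ Suc n"
          using Bernoulli_inequality[of "- (t / ?m)" "Suc n"] True
          by (simp del: power_Suc of_nat_Suc add: divide_le_eq)
        have "(1 - t / ?m) ^ Suc n \<le> exp (- t / ?m) ^ Suc n"
          using exp_ge_add_one_self[of "- t / ?m"] True by (intro power_mono) (auto simp: field_simps)
        also have "\<dots> = exp (- t)" by (simp add: exp_of_nat_mult[symmetric] del: of_nat_Suc power_Suc)
        also have "\<dots> \<le> 1 / (1 + t)"
          using exp_ge_add_one_self[of t] True by (simp add: exp_minus field_simps)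
        finally have hi: "(1 - t / ?m) ^ Suc n \<le> 1 / (1 + t)" .
        define p where "p = (1 - t / ?m) ^ Suc n"
        have "f n t = (p - 1 / (1 + t)) / t"
          using True by (simp add: f_def p_def)
        hence "norm (f n t) = (1 / (1 + t) - p) / t"
          using True hi[folded p_def] by (simp add: abs_divide)
        also have "\<dots> \<le> min (1 / (t * (1 + t))) (t / (1 + t))"
        proof (rule min.boundedI)
          have "(1 / (1 + t) - p) / t \<le> (1 / (1 + t)) / t"
            using nn True by (intro divide_right_mono) (auto simp: p_def)
          thus "(1 / (1 + t) - p) / t \<le> 1 / (t * (1 + t))"
            by (simp add: mult.commute)
          have "(1 / (1 + t) - p) / t \<le> (1 / (1 + t) - (1 - t)) / t"
            using lo True by (intro divide_right_mono) (auto simp: p_def)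
          also have "1 / (1 + t) - (1 - t) = t * (t / (1 + t))"
            using True by (simp add: divide_simps) (simp add: algebra_simps)
          also have "\<dots> / t = t / (1 + t)" using True by simp
          finally show "(1 / (1 + t) - p) / t \<le> t / (1 + t)" .
        qed
        also have "\<dots> \<le> 2 / (1 + t\<^sup>2)"
        proof (cases "t \<le> 1")
          case T: True
          have "t * t \<le> 1 * 1" using T True by (intro mult_mono) auto
          hence t2: "t\<^sup>2 \<le> 1" by (simp add: power2_eq_square)
          have "t / (1 + t) \<le> 1" using True by simp
          also have "1 \<le> 2 / (1 + t\<^sup>2)" using t2 by (intro mult_imp_le_div_pos add_pos_nonneg) auto
          finally show ?thesis by linarith
        next
          case False
          have "1 * 1 \<le> t * t" using False by (intro mult_mono) auto
          hence t2: "1 + t\<^sup>2 \<le> 2 * (t * (1 + t))" using False by (simp add: power2_eq_square algebra_simps)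
          have "1 / (t * (1 + t)) = 2 / (2 * (t * (1 + t)))" by simp
          also have "\<dots> \<le> 2 / (1 + t\<^sup>2)"
            using t2 by (intro frac_le add_pos_nonneg) auto
          finally show ?thesis by linarith
        qed
        finally show ?thesis .
      qed (use t in \<open>auto simp: f_def\<close>)
    qed
  next
    show "\<forall>t\<in>{0..}. (\<lambda>n. f n t) \<longlonglongrightarrow> (exp (- t) - 1 / (1 + t)) / t"
    proof
      fix t :: real assume t: "t \<in> {0..}"
      have "(\<lambda>n. (1 + (- t) / real (Suc n)) ^ Suc n) \<longlonglongrightarrow> exp (- t)"
        using LIMSEQ_Suc[OF tendsto_exp_limit_sequentially[of "- t"]] by simp
      hence "(\<lambda>n. ((1 + (- t) / real (Suc n)) ^ Suc n - 1 / (1 + t)) / t) \<longlonglongrightarrow> (exp (- t) - 1 / (1 + t)) / t"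
        by (cases "t = 0") (auto intro!: tendsto_intros simp del: of_nat_Suc power_Suc)
      moreover have "eventually (\<lambda>n. f n t = ((1 + (- t) / real (Suc n)) ^ Suc n - 1 / (1 + t)) / t) sequentially"
        using eventually_ge_at_top[of "nat \<lceil>t\<rceil>"]
      proof eventually_elim
        case (elim n)
        thus ?case using t by (simp add: f_def nat_ceiling_le_eq)
      qed
      ultimately show "(\<lambda>n. f n t) \<longlonglongrightarrow> (exp (- t) - 1 / (1 + t)) / t"
        using tendsto_cong by force
    qed
  next
    have "(\<lambda>n. ln (real n + 1) - ln (real n)) \<longlonglongrightarrow> 0"
    proof -
      have "(\<lambda>n. ln (1 + 1 / real n)) \<longlonglongrightarrow> ln (1 + 0)"
        by (intro tendsto_intros lim_1_over_n) auto
      moreover have "eventually (\<lambda>n. ln (1 + 1 / real n) = ln (real n + 1) - ln (real n)) sequentially"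
        using eventually_gt_at_top[of 0]
      proof eventually_elim
        case (elim n)
        hence "1 + 1 / real n = (real n + 1) / real n" by (simp add: field_simps)
        thus ?case using elim by (simp add: ln_div)
      qed
      ultimately show ?thesis using tendsto_cong by force
    qed
    from tendsto_diff[OF this euler_mascheroni_LIMSEQ]
    have "(\<lambda>n. ln (real n + 1) - harm n) \<longlonglongrightarrow> - euler_mascheroni" by simp
    from LIMSEQ_Suc[OF this]
    show "(\<lambda>n. ln (real (Suc n) + 1) - harm (Suc n)) \<longlonglongrightarrow> - euler_mascheroni" .
  qed
qed

section \<open>The characteristic function of a random subset sum\<close>

lemma zeta_power: "zeta N ^ k = cis (2 * pi * real k / real N)"
proof -
  have "zeta N ^ k = exp (of_nat k * (2 * of_real pi * \<i> / of_nat N))"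
    unfolding zeta_def by (rule exp_of_nat_mult [symmetric])
  also have "\<dots> = cis (2 * pi * real k / real N)"
    unfolding cis_conv_exp by (rule arg_cong[of _ _ exp]) simp
  finally show ?thesis .
qed

lemma norm_zeta_power [simp]: "norm (zeta N ^ k) = 1"
  by (simp add: zeta_power)

lemma zeta_power_eq_1_iff:
  assumes "N > 0"
  shows "zeta N ^ k = 1 \<longleftrightarrow> N dvd k"
proof -
  have "zeta N ^ k = exp (2 * of_real pi * \<i> * of_nat k / of_nat N)"
    by (simp add: zeta_power cis_conv_exp mult_ac)
  thus ?thesis
    using complex_root_unity_eq_1[of N k] assms by simp
qed

lemma sum_zeta_power:
  assumes "N > 0"
  shows "(\<Sum>i<N. zeta N ^ (i * k)) = (if N dvd k then of_nat N else 0)"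
proof (cases "N dvd k")
  case True
  hence "zeta N ^ (i * k) = 1" for i
    using zeta_power_eq_1_iff[OF assms, of "i * k"] by simp
  thus ?thesis using True by simp
next
  case False
  hence "zeta N ^ k \<noteq> 1" using zeta_power_eq_1_iff[OF assms] by simp
  moreover have "(zeta N ^ k) ^ N = 1"
    using zeta_power_eq_1_iff[OF assms, of "k * N"] by (simp add: power_mult)
  ultimately have "(\<Sum>i<N. (zeta N ^ k) ^ i) = 0"
    by (simp add: geometric_sum)
  thus ?thesis using False by (simp add: power_mult[symmetric] mult.commute)
qed

lemma sum_lessThan_eq_add_atLeastAtMost:
  fixes f :: "nat \<Rightarrow> 'a :: comm_monoid_add"
  assumes "N > 0"
  shows "(\<Sum>i<N. f i) = f 0 + (\<Sum>i=1..N-1. f i)"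
proof -
  have "{..<N} = insert 0 {1..N-1}" using assms by auto
  thus ?thesis by simp
qed

lemma sum_lessThan_periodic_shift:
  fixes f :: "nat \<Rightarrow> 'a :: ab_group_add"
  assumes "\<And>i. f (i + N) = f i"
  shows "(\<Sum>i<N. f (i + k)) = (\<Sum>i<N. f i)"
proof (induction k)
  case (Suc k)
  have "f k + (\<Sum>i<N. f (Suc i + k)) = (\<Sum>i<N. f (i + k)) + f (N + k)"
    using sum.lessThan_Suc_shift[of "\<lambda>i. f (i + k)" N] sum.lessThan_Suc[of "\<lambda>i. f (i + k)" N] by simp
  moreover have "f (N + k) = f k" using assms[of k] by (simp add: add.commute)
  ultimately show ?case using Suc by (simp add: add.commute)
qed simp

text \<open>Doubling the angle turns the oscillating part into a sum of squares of the roots of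
  unity, which vanishes unless \<open>N\<close> divides 2.\<close>

lemma sum_cos_squared:
  assumes "N \<ge> 3"
  shows "(\<Sum>i<N. (cos (2 * pi * real i / real N - \<theta>))\<^sup>2) = real N / 2"
proof -
  have "\<not> N dvd 2" using assms by (auto dest: dvd_imp_le)
  hence "0 = (\<Sum>i<N. cis (- 2 * \<theta>) * zeta N ^ (i * 2))"
    using sum_zeta_power[of N 2] assms by (simp add: sum_distrib_left[symmetric])
  also have "\<dots> = (\<Sum>i<N. cis (2 * (2 * pi * real i / real N - \<theta>)))"
    by (intro sum.cong refl) (simp add: zeta_power cis_mult algebra_simps)
  finally have "(\<Sum>i<N. cos (2 * (2 * pi * real i / real N - \<theta>))) = 0"
    by (simp add: complex_eq_iff)
  thus ?thesis
    unfolding cos_double_cos by (simp add: sum_subtractf sum_distrib_left[symmetric])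
qed

section \<open>Lower bounds for sums of squared sines at equally spaced angles\<close>

lemma sin_squared_ge:
  fixes x :: real
  assumes "\<bar>x\<bar> \<le> 1"
  shows "x\<^sup>2 / 4 \<le> (sin x)\<^sup>2"
proof -
  have "(\<lambda>u. sin u - u / 2) 0 \<le> (\<lambda>u. sin u - u / 2) \<bar>x\<bar>"
  proof (rule DERIV_nonneg_imp_nondecreasing[where f = "\<lambda>u. sin u - u / 2"])
    fix u :: real assume u: "0 \<le> u" "u \<le> \<bar>x\<bar>"
    \<comment> \<open>The interval \<open>{0..1}\<close> lies below \<open>pi / 3\<close>, so the
      derivative of \<open>sin u - u / 2\<close> is nonnegative on it.\<close>
    have "cos (pi / 3) \<le> cos u"
      using u assms pi_gt3 by (intro cos_monotone_0_pi_le) auto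
    hence "0 \<le> cos u - 1 / 2" by (simp add: cos_60)
    moreover have "((\<lambda>u. sin u - u / 2) has_real_derivative (cos u - 1 / 2)) (at u)"
      by (auto intro!: derivative_eq_intros)
    ultimately show "\<exists>y. ((\<lambda>u. sin u - u / 2) has_real_derivative y) (at u) \<and> 0 \<le> y" by blast
  qed simp
  hence "(\<bar>x\<bar> / 2)\<^sup>2 \<le> (sin \<bar>x\<bar>)\<^sup>2"
    by (intro power_mono) auto
  thus ?thesis by (cases "x \<ge> 0") (simp_all add: power_divide)
qed

text \<open>Up to the term \<open>i = 0\<close> and a factor 2, a lower bound for minus the
  logarithm of the modulus of \<open>subset_char\<close>, at \<open>r = norm w / sqrt N\<close> and
  \<open>\<theta> = Arg w\<close>. Including \<open>i = 0\<close> makes the sum shift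
  invariant.\<close>

definition sine_energy :: "nat \<Rightarrow> real \<Rightarrow> real \<Rightarrow> real" where
  "sine_energy N r \<theta> = (\<Sum>i<N. (sin (r * cos (2 * pi * real i / real N - \<theta>)))\<^sup>2)"

lemma sine_energy_ge_small:
  assumes "N \<ge> 3" "\<bar>r\<bar> \<le> 1"
  shows "r\<^sup>2 * real N / 8 \<le> sine_energy N r \<theta>"
proof -
  have "r\<^sup>2 * real N / 8 = (\<Sum>i<N. (r * cos (2 * pi * real i / real N - \<theta>))\<^sup>2 / 4)"
    using sum_cos_squared[OF assms(1), of \<theta>]
    by (simp add: power_mult_distrib sum_divide_distrib[symmetric] sum_distrib_left[symmetric])
  also have "\<dots> \<le> sine_energy N r \<theta>"
    unfolding sine_energy_def
  proof (intro sum_mono sin_squared_ge)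
    fix i
    have "\<bar>r\<bar> * \<bar>cos (2 * pi * real i / real N - \<theta>)\<bar> \<le> 1 * 1"
      using assms by (intro mult_mono) auto
    thus "\<bar>r * cos (2 * pi * real i / real N - \<theta>)\<bar> \<le> 1" by (simp add: abs_mult)
  qed
  finally show ?thesis .
qed

lemma sin_squared_diff_le:
  fixes a b :: real
  shows "(sin (a - b))\<^sup>2 \<le> 2 * (sin a)\<^sup>2 + 2 * (sin b)\<^sup>2"
proof -
  have "\<bar>sin (a - b)\<bar> \<le> \<bar>sin a * cos b\<bar> + \<bar>cos a * sin b\<bar>"
    by (simp add: sin_diff)
  also have "\<dots> \<le> \<bar>sin a\<bar> + \<bar>sin b\<bar>"
    by (intro add_mono) (auto simp: abs_mult intro: mult_left_le mult_left_le_one_le)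
  finally have "(sin (a - b))\<^sup>2 \<le> (\<bar>sin a\<bar> + \<bar>sin b\<bar>)\<^sup>2"
    by (metis abs_ge_zero power2_abs power_mono)
  also have "\<dots> \<le> 2 * (sin a)\<^sup>2 + 2 * (sin b)\<^sup>2"
    using zero_le_power2[of "\<bar>sin a\<bar> - \<bar>sin b\<bar>"] by (simp add: power2_sum power2_diff)
  finally show ?thesis .
qed

text \<open>Differencing the samples with a shift of \<open>k\<close> lowers the amplitude \<open>r\<close> to any desired
  smaller value; this reduces large amplitudes to the range where sine is essentially linear.\<close>

lemma sine_energy_shift:
  assumes "N > 0"
  shows "sine_energy N (2 * r * sin (real k * pi / real N)) (\<theta> + pi / 2 - real k * pi / real N)
           \<le> 4 * sine_energy N r \<theta>"
proof -
  define s where "s = (\<lambda>i. r * cos (2 * pi * real i / real N - \<theta>))"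
  have per: "s (i + N) = s i" for i
  proof -
    have "2 * pi * real (i + N) / real N - \<theta> = (2 * pi * real i / real N - \<theta>) + 2 * pi"
      using assms by (simp add: field_simps)
    thus ?thesis unfolding s_def by (simp only: cos_periodic)
  qed
  have diff: "s i - s (i + k) = 2 * r * sin (real k * pi / real N) *
      cos (2 * pi * real i / real N - (\<theta> + pi / 2 - real k * pi / real N))" for i
  proof -
    define a where "a = 2 * pi * real i / real N - \<theta>"
    define b where "b = real k * pi / real N"
    have 1: "2 * pi * real (i + k) / real N - \<theta> = a + 2 * b"
      by (simp add: a_def b_def distrib_left add_divide_distrib mult_ac)
    have "cos a - cos (a + 2 * b) = 2 * sin ((a + (a + 2 * b)) / 2) * sin (((a + 2 * b) - a) / 2)"
      by (rule cos_diff_cos)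
    also have "(a + (a + 2 * b)) / 2 = a + b" by simp
    also have "((a + 2 * b) - a) / 2 = b" by simp
    also have "sin (a + b) = cos (a + b - pi / 2)" by (simp add: cos_diff)
    finally have "cos a - cos (a + 2 * b) = 2 * cos (a + b - pi / 2) * sin b" .
    moreover have 2: "2 * pi * real i / real N - (\<theta> + pi / 2 - b) = a + b - pi / 2"
      by (simp add: a_def)
    ultimately show ?thesis
      unfolding s_def 1 a_def[symmetric] b_def[symmetric] 2 by (simp add: right_diff_distrib[symmetric])
  qed
  have "sine_energy N (2 * r * sin (real k * pi / real N)) (\<theta> + pi / 2 - real k * pi / real N)
      = (\<Sum>i<N. (sin (s i - s (i + k)))\<^sup>2)"
    unfolding sine_energy_def diff ..
  also have "\<dots> \<le> (\<Sum>i<N. 2 * (sin (s i))\<^sup>2 + 2 * (sin (s (i + k)))\<^sup>2)"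
    by (intro sum_mono sin_squared_diff_le)
  also have "\<dots> = 2 * (\<Sum>i<N. (sin (s i))\<^sup>2) + 2 * (\<Sum>i<N. (sin (s (i + k)))\<^sup>2)"
    by (simp add: sum.distrib sum_distrib_left)
  also have "(\<Sum>i<N. (sin (s (i + k)))\<^sup>2) = (\<Sum>i<N. (sin (s i))\<^sup>2)"
    by (rule sum_lessThan_periodic_shift) (simp add: per)
  finally show ?thesis by (simp add: sine_energy_def s_def)
qed

text \<open>Up to amplitude 1, sine is comparable to its argument. Above 1, a shift by about
  \<open>N / (2 * pi * r)\<close> moves the amplitude between \<open>1 / 4\<close> and 1; the small
  case then gives \<open>N / 128\<close>, and the shift costs a factor 4. The limit on
  \<open>r\<close> ensures a shift of at least two steps.\<close>

lemma sine_energy_ge: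
  assumes "N \<ge> 3" "0 \<le> r" "r \<le> real N / (4 * pi)"
  shows "min (r\<^sup>2) 1 * real N / 512 \<le> sine_energy N r \<theta>"
proof (cases "r \<le> 1")
  case True
  have "min (r\<^sup>2) 1 * real N / 512 \<le> r\<^sup>2 * real N / 8"
    by (intro frac_le mult_right_mono) auto
  with sine_energy_ge_small[OF assms(1), of r \<theta>] True assms show ?thesis by linarith
next
  case False
  define k where "k = nat \<lfloor>real N / (2 * pi * r)\<rfloor>"
  define x where "x = real k * pi / real N"
  have r: "r > 1" using False by simp
  have big: "2 \<le> real N / (2 * pi * r)" using assms r by (simp add: field_simps)
  have k1: "real k \<le> real N / (2 * pi * r)"
    unfolding k_def using big by (intro of_nat_floor) auto
  have k2: "real N / (2 * pi * r) - 1 \<le> real k"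
    unfolding k_def using big by linarith
  \<comment> \<open>The rounded quantity is at least 2, so rounding down loses at most half of it;
    this pins \<open>x\<close> between \<open>1 / (4 * r)\<close> and
    \<open>1 / (2 * r)\<close>.\<close>
  have k3: "real N / (4 * pi * r) \<le> real k"
    using k2 big by (simp add: field_simps)
  have xu: "x \<le> 1 / (2 * r)"
    using k1 r assms unfolding x_def by (simp add: field_simps)
  have xl: "1 / (4 * r) \<le> x"
    using k3 r assms unfolding x_def by (simp add: field_simps)
  have x0: "0 < x" using xl r by (smt (verit) divide_pos_pos)
  have "1 / (2 * r) \<le> 1" using r by simp
  hence x1: "x \<le> 1" using xu by simp
  have "sin x \<le> x" using x0 sin_x_le_x by simp
  have sx0: "0 < sin x" using x0 x1 pi_gt3 by (intro sin_gt_zero) auto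
  define r' where "r' = 2 * r * sin x"
  have r'0: "0 < r'" using sx0 r by (simp add: r'_def)
  have "r' \<le> 2 * r * (1 / (2 * r))"
    unfolding r'_def using \<open>sin x \<le> x\<close> xu r by (intro mult_left_mono) auto
  hence r'1: "r' \<le> 1" using r by simp
  have "(1 / (4 * r))\<^sup>2 / 4 \<le> x\<^sup>2 / 4"
    using xl r by (intro divide_right_mono power_mono) auto
  also have "\<dots> \<le> (sin x)\<^sup>2"
    using x0 x1 by (intro sin_squared_ge) auto
  finally have "4 * r\<^sup>2 * ((1 / (4 * r))\<^sup>2 / 4) \<le> 4 * r\<^sup>2 * (sin x)\<^sup>2"
    by (intro mult_left_mono) auto
  hence "1 / 16 \<le> r'\<^sup>2"
    using r by (simp add: r'_def power_mult_distrib power_divide)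
  hence "1 / 16 * real N / 8 \<le> r'\<^sup>2 * real N / 8"
    by (intro divide_right_mono mult_right_mono) auto
  also have "\<dots> \<le> sine_energy N r' (\<theta> + pi / 2 - x)"
    using r'0 r'1 by (intro sine_energy_ge_small assms) auto
  also have "\<dots> \<le> 4 * sine_energy N r \<theta>"
    unfolding r'_def x_def using assms by (intro sine_energy_shift) auto
  finally have "real N / 512 \<le> sine_energy N r \<theta>" by simp
  moreover have "min (r\<^sup>2) 1 * real N / 512 \<le> 1 * real N / 512"
    by (intro divide_right_mono mult_right_mono) auto
  ultimately show ?thesis by linarith
qed

text \<open>The factor \<open>2 / sqrt N\<close> makes the mean squared modulus over all subsets
  exactly 1, the mean of the limiting exponential law.\<close>

definition normalised_sum :: "nat \<Rightarrow> nat set \<Rightarrow> complex" where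
  "normalised_sum N A = (2 / sqrt (real N)) *\<^sub>R (\<Sum>i\<in>A. zeta N ^ i)"

text \<open>The empty set is included so that memberships of the indices are independent and the
  average factorises; it is taken out again in \<open>laplace_gap\<close>.\<close>

definition subset_char :: "nat \<Rightarrow> complex \<Rightarrow> complex" where
  "subset_char N w = (\<Sum>A\<in>Pow {1..N-1}. cis (w \<bullet> normalised_sum N A)) / 2 ^ (N - 1)"

lemma cis_sum: "cis (\<Sum>i\<in>A. f i) = (\<Prod>i\<in>A. cis (f i))"
  by (induction A rule: infinite_finite_induct) (auto simp: cis_mult[symmetric])

lemma one_plus_cis: "(1 + cis (2 * b)) / 2 = cis b * of_real (cos b)"
  by (simp add: complex_eq_iff cos_double_cos sin_double power2_eq_square)

lemma inner_normalised_sum: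
  "w \<bullet> normalised_sum N A = (\<Sum>i\<in>A. 2 * (w \<bullet> zeta N ^ i / sqrt (real N)))"
  by (simp add: normalised_sum_def inner_sum_right sum_distrib_left sum_divide_distrib)

lemma subset_char_eq_prod:
  "subset_char N w = (\<Prod>i=1..N-1. cis (w \<bullet> zeta N ^ i / sqrt (real N)) *
     of_real (cos (w \<bullet> zeta N ^ i / sqrt (real N))))"
proof -
  define b where "b = (\<lambda>i. w \<bullet> zeta N ^ i / sqrt (real N))"
  have "(\<Prod>i=1..N-1. cis (b i) * of_real (cos (b i))) = (\<Prod>i=1..N-1. (cis (2 * b i) + 1) / 2)"
    by (intro prod.cong refl) (metis one_plus_cis add.commute)
  also have "\<dots> = (\<Prod>i=1..N-1. cis (2 * b i) + 1) / 2 ^ (N - 1)"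
    by (simp add: prod_dividef)
  also have "(\<Prod>i=1..N-1. cis (2 * b i) + 1) = (\<Sum>A\<in>Pow {1..N-1}. \<Prod>i\<in>A. cis (2 * b i))"
    by (subst prod_add) auto
  also have "\<dots> = (\<Sum>A\<in>Pow {1..N-1}. cis (w \<bullet> normalised_sum N A))"
    unfolding inner_normalised_sum b_def cis_sum ..
  finally show ?thesis by (simp add: subset_char_def b_def)
qed

lemma norm_subset_char_le_1: "norm (subset_char N w) \<le> 1"
  unfolding subset_char_eq_prod prod_norm[symmetric]
  by (intro prod_le_1) (auto simp: norm_mult)

lemma abs_cos_le_exp: "\<bar>cos x\<bar> \<le> exp (- (sin x)\<^sup>2 / 2)" for x :: real
proof (rule power2_le_imp_le)
  have "\<bar>cos x\<bar>\<^sup>2 = 1 + - (sin x)\<^sup>2" by (simp add: cos_squared_eq)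
  also have "\<dots> \<le> exp (- (sin x)\<^sup>2)" by (rule exp_ge_add_one_self)
  also have "\<dots> = (exp (- (sin x)\<^sup>2 / 2))\<^sup>2" by (simp flip: exp_double)
  finally show "\<bar>cos x\<bar>\<^sup>2 \<le> (exp (- (sin x)\<^sup>2 / 2))\<^sup>2" .
qed simp

lemma inner_zeta_power:
  "w \<bullet> zeta N ^ i = norm w * cos (2 * pi * real i / real N - Arg w)"
proof -
  have w: "w = rcis (norm w) (Arg w)" by (simp add: rcis_cmod_Arg)
  show ?thesis
    by (subst w) (simp add: inner_complex_def zeta_power cos_diff algebra_simps)
qed

text \<open>The product over cosines lacks index 0, whose squared sine is at most 1: this is the
  summand \<open>1 / 2\<close> in the exponent. The radius is the range of
  \<open>sine_energy_ge\<close> for \<open>r = norm w / sqrt N\<close>.\<close>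

lemma norm_subset_char_le:
  assumes "N \<ge> 3" and "norm w \<le> sqrt (real N) * real N / (4 * pi)"
  shows "norm (subset_char N w) \<le> exp (1 / 2 - min ((norm w)\<^sup>2) (real N) / 1024)"
proof -
  define b where "b = (\<lambda>i. w \<bullet> zeta N ^ i / sqrt (real N))"
  define r where "r = norm w / sqrt (real N)"
  have N: "real N > 0" using assms by simp
  have b: "b i = r * cos (2 * pi * real i / real N - Arg w)" for i
    by (simp add: b_def r_def inner_zeta_power)
  have r: "0 \<le> r" "r \<le> real N / (4 * pi)"
    using assms N by (simp_all add: r_def divide_simps mult_ac)
  have "sine_energy N r (Arg w) = (sin (b 0))\<^sup>2 + (\<Sum>i=1..N-1. (sin (b i))\<^sup>2)"
    unfolding sine_energy_def b using N by (intro sum_lessThan_eq_add_atLeastAtMost) simp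
  also have "(sin (b 0))\<^sup>2 \<le> 1" by (simp add: abs_square_le_1)
  finally have "sine_energy N r (Arg w) - 1 \<le> (\<Sum>i=1..N-1. (sin (b i))\<^sup>2)" by simp
  moreover have "min (r\<^sup>2) 1 * real N / 512 \<le> sine_energy N r (Arg w)"
    by (intro sine_energy_ge assms r)
  moreover have "min (r\<^sup>2) 1 * real N = min ((norm w)\<^sup>2) (real N)"
    using N by (simp add: r_def min_mult_distrib_right power_divide)
  ultimately have S: "min ((norm w)\<^sup>2) (real N) / 512 - 1 \<le> (\<Sum>i=1..N-1. (sin (b i))\<^sup>2)"
    by simp
  have "norm (subset_char N w) = (\<Prod>i=1..N-1. \<bar>cos (b i)\<bar>)"
    unfolding subset_char_eq_prod prod_norm[symmetric] b_def by (simp add: norm_mult)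
  also have "\<dots> \<le> (\<Prod>i=1..N-1. exp (- (sin (b i))\<^sup>2 / 2))"
    by (intro prod_mono) (auto intro: abs_cos_le_exp[simplified])
  also have "\<dots> = exp (- (\<Sum>i=1..N-1. (sin (b i))\<^sup>2) / 2)"
    by (simp add: exp_sum sum_divide_distrib sum_negf[symmetric])
  also have "\<dots> \<le> exp (1 / 2 - min ((norm w)\<^sup>2) (real N) / 1024)"
    using S by simp
  finally show ?thesis .
qed

text \<open>Both functions agree with \<open>1 - b^2 / 2\<close> up to fourth order, with errors at
  most \<open>b ^ 4 / 24\<close> and \<open>b ^ 4 / 8\<close> on the whole line.\<close>

lemma cos_exp_diff_le: "\<bar>cos b - exp (- (b\<^sup>2 / 2))\<bar> \<le> b ^ 4" for b :: real
proof -
  define y where "y = b\<^sup>2 / 2"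
  have y: "0 \<le> y" by (simp add: y_def)
  have "cmod (iexp b - (\<Sum>k\<le>3. (\<i> * b) ^ k / fact k)) \<le> \<bar>b\<bar> ^ Suc 3 / fact (Suc 3)"
    by (rule iexp_approx1)
  hence "\<bar>Re (iexp b - (\<Sum>k\<le>3. (\<i> * b) ^ k / fact k))\<bar> \<le> \<bar>b\<bar> ^ Suc 3 / fact (Suc 3)"
    using abs_Re_le_cmod order_trans by blast
  also have "Re (iexp b - (\<Sum>k\<le>3. (\<i> * b) ^ k / fact k)) = cos b - (1 - y)"
    by (simp add: numeral_3_eq_3 y_def power2_eq_square cis_conv_exp[symmetric] field_simps)
  finally have 1: "\<bar>cos b - (1 - y)\<bar> \<le> b ^ 4 / 24"
    by (simp add: numeral_3_eq_3 fact_reduce eval_nat_numeral)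
  have "1 + y + y\<^sup>2 / 2 \<le> exp y" by (rule exp_lower_Taylor_quadratic[OF y])
  \<comment> \<open>Multiplying the Taylor polynomial by its alternating counterpart gives
    \<open>1 + y ^ 4 / 4\<close>, which converts the lower bound for \<open>exp y\<close> into an
    upper bound for \<open>exp (- y)\<close>.\<close>
  moreover have "1 \<le> (1 + y + y\<^sup>2 / 2) * (1 - y + y\<^sup>2 / 2)"
  proof -
    have "(1 + y + y\<^sup>2 / 2) * (1 - y + y\<^sup>2 / 2) = 1 + y ^ 4 / 4"
      by (simp add: field_simps power2_eq_square power4_eq_xxxx)
    thus ?thesis by simp
  qed
  moreover have "0 \<le> 1 - y + y\<^sup>2 / 2"
    using zero_le_power2[of "y - 1"] by (simp add: power2_diff)
  ultimately have "1 \<le> exp y * (1 - y + y\<^sup>2 / 2)"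
    by (meson mult_right_mono order_trans)
  hence "exp (- y) \<le> 1 - y + y\<^sup>2 / 2"
    by (simp add: exp_minus field_simps)
  moreover have "1 - y \<le> exp (- y)" using exp_ge_add_one_self[of "- y"] by simp
  moreover have "y\<^sup>2 / 2 = b ^ 4 / 8" by (simp add: y_def power_divide)
  moreover have "0 \<le> b ^ 4" by simp
  ultimately show ?thesis using 1 unfolding y_def[symmetric] by linarith
qed

lemma sum_zeta_power_nonzero:
  assumes "N \<ge> 2"
  shows "(\<Sum>i=1..N-1. zeta N ^ i) = -1"
proof -
  have "\<not> N dvd 1" using assms by auto
  hence "(\<Sum>i<N. zeta N ^ i) = 0"
    using sum_zeta_power[of N 1] assms by simp
  hence "1 + (\<Sum>i=1..N-1. zeta N ^ i) = 0"
    using sum_lessThan_eq_add_atLeastAtMost[of N "\<lambda>i. zeta N ^ i"] assms by simp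
  thus ?thesis by (simp add: add_eq_0_iff)
qed

text \<open>The phases add up to \<open>- Re w / sqrt N\<close>, since the nontrivial roots of unity
  sum to -1, and so disappear. Every angle is of order \<open>1 / sqrt N\<close>, so trading cosines
  for Gaussians costs \<open>N\<close> errors of order \<open>1 / N^2\<close>; the product of
  Gaussians is explicit from the sum of squared cosines.\<close>

lemma subset_char_tendsto:
  "(\<lambda>N. subset_char N w) \<longlonglongrightarrow> of_real (exp (- ((norm w)\<^sup>2 / 4)))"
proof -
  define b where "b = (\<lambda>N i. w \<bullet> zeta N ^ i / sqrt (real N))"
  define phase where "phase = (\<lambda>N. - Re w / sqrt (real N))"
  define P where "P = (\<lambda>N. \<Prod>i=1..N-1. cos (b N i))"
  define Q where "Q = (\<lambda>N. exp (- ((norm w)\<^sup>2 / 4) + (Re w)\<^sup>2 / (2 * real N)))"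
  have eq: "subset_char N w = cis (phase N) * of_real (P N)" if "N \<ge> 3" for N
  proof -
    have "phase N = (w \<bullet> (\<Sum>i=1..N-1. zeta N ^ i)) / sqrt (real N)"
      using that by (subst sum_zeta_power_nonzero) (auto simp: phase_def inner_complex_def)
    also have "\<dots> = (\<Sum>i=1..N-1. b N i)"
      by (simp add: b_def inner_sum_right sum_divide_distrib)
    finally have "phase N = (\<Sum>i=1..N-1. b N i)" .
    thus ?thesis
      by (simp add: subset_char_eq_prod cis_sum prod.distrib P_def b_def)
  qed
  have PQ: "\<bar>P N - Q N\<bar> \<le> (norm w) ^ 4 / real N" if "N \<ge> 3" for N
  proof -
    have N: "real N > 0" using that by simp
    have b: "b N i = norm w / sqrt (real N) * cos (2 * pi * real i / real N - Arg w)" for i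
      by (simp add: b_def inner_zeta_power)
    have b0: "b N 0 = Re w / sqrt (real N)" by (simp add: b_def inner_complex_def)
    have "(\<Sum>i<N. (b N i)\<^sup>2) = (norm w / sqrt (real N))\<^sup>2 * (real N / 2)"
      unfolding b power_mult_distrib sum_distrib_left[symmetric] sum_cos_squared[OF that] ..
    hence "(\<Sum>i<N. (b N i)\<^sup>2) = (norm w)\<^sup>2 / 2"
      using N by (simp add: power_divide)
    hence "(Re w)\<^sup>2 / real N + (\<Sum>i=1..N-1. (b N i)\<^sup>2) = (norm w)\<^sup>2 / 2"
      using sum_lessThan_eq_add_atLeastAtMost[of N "\<lambda>i. (b N i)\<^sup>2"] N
      by (simp add: b0 power_divide)
    hence sq: "(\<Sum>i=1..N-1. - ((b N i)\<^sup>2 / 2)) = - ((norm w)\<^sup>2 / 4) + (Re w)\<^sup>2 / (2 * real N)"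
      by (simp add: sum_negf sum_divide_distrib[symmetric] field_simps)
    have Q: "Q N = (\<Prod>i=1..N-1. exp (- ((b N i)\<^sup>2 / 2)))"
      unfolding Q_def sq[symmetric] by (simp add: exp_sum)
    \<comment> \<open>All factors have modulus at most 1, so replacing them one at a time bounds the
      difference of the products by the sum of the differences.\<close>
    have "norm (P N - Q N) \<le> (\<Sum>i=1..N-1. norm (cos (b N i) - exp (- ((b N i)\<^sup>2 / 2))))"
      unfolding P_def Q by (intro norm_prod_diff) auto
    also have "\<dots> \<le> (\<Sum>i=1..N-1. (norm w / sqrt (real N)) ^ 4)"
    proof (intro sum_mono)
      fix i
      have "norm (cos (b N i) - exp (- ((b N i)\<^sup>2 / 2))) \<le> (b N i) ^ 4"
        using cos_exp_diff_le by simp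
      also have "\<dots> = \<bar>b N i\<bar> ^ 4" by simp
      also have "\<bar>b N i\<bar> ^ 4 \<le> (norm w / sqrt (real N) * 1) ^ 4"
        unfolding b abs_mult by (intro power_mono mult_mono) auto
      finally show "norm (cos (b N i) - exp (- ((b N i)\<^sup>2 / 2))) \<le> (norm w / sqrt (real N)) ^ 4"
        by simp
    qed
    also have "\<dots> \<le> real N * (norm w / sqrt (real N)) ^ 4"
      by (simp add: mult_right_mono)
    also have "\<dots> = (norm w) ^ 4 / real N"
    proof -
      have "sqrt (real N) ^ 4 = (sqrt (real N) ^ 2) ^ 2" by (simp only: power_mult[symmetric]) simp
      hence "sqrt (real N) ^ 4 = real N ^ 2" by simp
      thus ?thesis using N by (simp add: power_divide power2_eq_square)
    qed
    finally show ?thesis by simp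
  qed
  have "(\<lambda>N. P N - Q N) \<longlonglongrightarrow> 0"
  proof (rule Lim_null_comparison)
    show "eventually (\<lambda>N. norm (P N - Q N) \<le> (norm w) ^ 4 / real N) sequentially"
      using eventually_ge_at_top[of 3] by eventually_elim (use PQ in simp)
    show "(\<lambda>N. (norm w) ^ 4 / real N) \<longlonglongrightarrow> 0"
      by (rule lim_const_over_n)
  qed
  moreover have "Q \<longlonglongrightarrow> exp (- ((norm w)\<^sup>2 / 4) + 0)"
  proof -
    have "(\<lambda>N. (Re w)\<^sup>2 / 2 / real N) \<longlonglongrightarrow> 0" by (rule lim_const_over_n)
    thus ?thesis unfolding Q_def by (intro tendsto_intros) simp
  qed
  ultimately have "(\<lambda>N. (P N - Q N) + Q N) \<longlonglongrightarrow> 0 + exp (- ((norm w)\<^sup>2 / 4) + 0)"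
    by (rule tendsto_add)
  hence P: "P \<longlonglongrightarrow> exp (- ((norm w)\<^sup>2 / 4))" by simp
  have "(\<lambda>N. phase N) \<longlonglongrightarrow> 0"
    unfolding phase_def
    by (intro real_tendsto_divide_at_top[OF tendsto_const] filterlim_compose[OF sqrt_at_top]
        filterlim_real_sequentially)
  hence "(\<lambda>N. cis (phase N) * of_real (P N)) \<longlonglongrightarrow> cis 0 * of_real (exp (- ((norm w)\<^sup>2 / 4)))"
    using P by (intro tendsto_intros)
  moreover have "eventually (\<lambda>N. subset_char N w = cis (phase N) * of_real (P N)) sequentially"
    using eventually_ge_at_top[of 3] by eventually_elim (use eq in simp)
  ultimately show ?thesis
    using tendsto_cong by force
qed

section \<open>Gaussian averaging\<close>

lemma integrable_std_normal_exp_square: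
  assumes "a > -1"
  shows "integrable std_normal_distribution (\<lambda>x. exp (- (a * x\<^sup>2 / 2)))"
    and "(\<integral>x. exp (- (a * x\<^sup>2 / 2)) \<partial>std_normal_distribution) = 1 / sqrt (1 + a)"
proof -
  \<comment> \<open>The extra exponential rescales the Gaussian to variance
    \<open>1 / (1 + a)\<close>.\<close>
  define \<sigma> where "\<sigma> = 1 / sqrt (1 + a)"
  have \<sigma>: "\<sigma> > 0" "\<sigma>\<^sup>2 = 1 / (1 + a)" using assms by (simp_all add: \<sigma>_def power_divide)
  have eq: "std_normal_density x *\<^sub>R exp (- (a * x\<^sup>2 / 2)) = \<sigma> * normal_density 0 \<sigma> x" for x
  proof -
    have "std_normal_density x *\<^sub>R exp (- (a * x\<^sup>2 / 2)) = 1 / sqrt (2 * pi) * exp (- (x\<^sup>2 / 2) + - (a * x\<^sup>2 / 2))"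
      by (simp add: std_normal_density_def exp_add[symmetric] exp_diff[symmetric])
    also have "- (x\<^sup>2 / 2) + - (a * x\<^sup>2 / 2) = - (x - 0)\<^sup>2 / (2 * \<sigma>\<^sup>2)"
      using assms by (simp add: \<sigma>(2) field_simps)
    also have "1 / sqrt (2 * pi) = \<sigma> * (1 / sqrt (2 * pi * \<sigma>\<^sup>2))"
      using \<sigma>(1) by (simp add: real_sqrt_mult)
    finally show ?thesis by (simp add: normal_density_def)
  qed
  show "integrable std_normal_distribution (\<lambda>x. exp (- (a * x\<^sup>2 / 2)))"
    by (subst integrable_density) (auto simp: eq \<sigma>(1) simp del: real_scaleR_def)
  show "(\<integral>x. exp (- (a * x\<^sup>2 / 2)) \<partial>std_normal_distribution) = 1 / sqrt (1 + a)"
    by (subst integral_density) (auto simp: eq \<sigma>(1) simp flip: \<sigma>_def simp del: real_scaleR_def)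
qed

lemma integral_std_normal_cis:
  "(\<integral>x. cis (a * x) \<partial>std_normal_distribution) = of_real (exp (- (a\<^sup>2 / 2)))"
  using fun_cong[OF char_std_normal_distribution, of a]
  by (simp add: char_def cis_conv_exp mult_ac)

lemma (in pair_sigma_finite)
  fixes f :: "_ \<Rightarrow> 'c :: {banach, second_countable_topology, real_normed_field}"
  assumes f: "integrable M1 f" and g: "integrable M2 g"
  shows integrable_pair_mult: "integrable (M1 \<Otimes>\<^sub>M M2) (\<lambda>z. f (fst z) * g (snd z))"
    and integral_pair_mult: "(\<integral>z. f (fst z) * g (snd z) \<partial>(M1 \<Otimes>\<^sub>M M2)) = integral\<^sup>L M1 f * integral\<^sup>L M2 g"
proof -
  have [measurable]: "f \<in> borel_measurable M1" "g \<in> borel_measurable M2"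
    using f g by auto
  show int: "integrable (M1 \<Otimes>\<^sub>M M2) (\<lambda>z. f (fst z) * g (snd z))"
    by (rule Fubini_integrable) (use f g in \<open>auto simp: norm_mult\<close>)
  have "(\<integral>z. f (fst z) * g (snd z) \<partial>(M1 \<Otimes>\<^sub>M M2)) = (\<integral>x. (\<integral>y. f x * g y \<partial>M2) \<partial>M1)"
    using integral_fst'[OF int] by simp
  thus "(\<integral>z. f (fst z) * g (snd z) \<partial>(M1 \<Otimes>\<^sub>M M2)) = integral\<^sup>L M1 f * integral\<^sup>L M2 g"
    using f g by simp
qed

interpretation std_normal: prob_space std_normal_distribution
  by (rule prob_space_normal_density) simp

interpretation std_normal_pair: pair_prob_space std_normal_distribution std_normal_distribution ..

abbreviation std_normal_2d :: "(real \<times> real) measure" where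
  "std_normal_2d \<equiv> std_normal_distribution \<Otimes>\<^sub>M std_normal_distribution"

lemma std_normal_2d_exp_square:
  assumes "a > -1"
  shows "integrable std_normal_2d (\<lambda>z. exp (- (a * ((fst z)\<^sup>2 + (snd z)\<^sup>2) / 2)))"
    and "(\<integral>z. exp (- (a * ((fst z)\<^sup>2 + (snd z)\<^sup>2) / 2)) \<partial>std_normal_2d) = 1 / (1 + a)"
proof -
  have eq: "exp (- (a * ((fst z)\<^sup>2 + (snd z)\<^sup>2) / 2)) = exp (- (a * (fst z)\<^sup>2 / 2)) * exp (- (a * (snd z)\<^sup>2 / 2))"
    for z :: "real \<times> real"
    by (simp add: exp_add[symmetric] distrib_left add_divide_distrib)
  note int = integrable_std_normal_exp_square[OF assms]
  show "integrable std_normal_2d (\<lambda>z. exp (- (a * ((fst z)\<^sup>2 + (snd z)\<^sup>2) / 2)))"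
    unfolding eq by (rule std_normal_pair.integrable_pair_mult[OF int(1) int(1)])
  show "(\<integral>z. exp (- (a * ((fst z)\<^sup>2 + (snd z)\<^sup>2) / 2)) \<partial>std_normal_2d) = 1 / (1 + a)"
    unfolding eq using assms
    by (simp add: std_normal_pair.integral_pair_mult[OF int(1) int(1)] int(2) real_sqrt_mult[symmetric])
qed

text \<open>A Gaussian of variance \<open>2 * t\<close> trades the squared norm in an exponent for a
  linear phase, so the Laplace transform of the squared modulus becomes an average of
  \<open>subset_char\<close>.\<close>

lemma std_normal_2d_cis:
  fixes v :: complex
  assumes "t \<ge> 0"
  shows "integrable std_normal_2d (\<lambda>z. cis ((sqrt (2 * t) *\<^sub>R Complex (fst z) (snd z)) \<bullet> v))"
    and "(\<integral>z. cis ((sqrt (2 * t) *\<^sub>R Complex (fst z) (snd z)) \<bullet> v) \<partial>std_normal_2d)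
           = of_real (exp (- (t * (norm v)\<^sup>2)))"
proof -
  have eq: "cis ((sqrt (2 * t) *\<^sub>R Complex (fst z) (snd z)) \<bullet> v) =
      cis ((sqrt (2 * t) * Re v) * fst z) * cis ((sqrt (2 * t) * Im v) * snd z)" for z
    by (simp add: cis_mult inner_complex_def algebra_simps)
  have int: "integrable std_normal_distribution (\<lambda>x. cis (a * x))" for a
  proof (rule std_normal.integrable_const_bound[where B = 1])
    show "(\<lambda>x. cis (a * x)) \<in> borel_measurable std_normal_distribution"
      by (simp, intro borel_measurable_continuous_onI continuous_intros)
  qed auto
  show "integrable std_normal_2d (\<lambda>z. cis ((sqrt (2 * t) *\<^sub>R Complex (fst z) (snd z)) \<bullet> v))"
    unfolding eq by (rule std_normal_pair.integrable_pair_mult[OF int int])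
  have "(\<integral>z. cis ((sqrt (2 * t) *\<^sub>R Complex (fst z) (snd z)) \<bullet> v) \<partial>std_normal_2d) =
      of_real (exp (- ((sqrt (2 * t) * Re v)\<^sup>2 / 2)) * exp (- ((sqrt (2 * t) * Im v)\<^sup>2 / 2)))"
    unfolding eq by (simp only: std_normal_pair.integral_pair_mult[OF int int] integral_std_normal_cis of_real_mult)
  also have "\<dots> = of_real (exp (- ((sqrt (2 * t) * Re v)\<^sup>2 / 2) + - ((sqrt (2 * t) * Im v)\<^sup>2 / 2)))"
    by (simp only: exp_add)
  also have "- ((sqrt (2 * t) * Re v)\<^sup>2 / 2) + - ((sqrt (2 * t) * Im v)\<^sup>2 / 2) = - (t * (norm v)\<^sup>2)"
    using assms by (simp add: power_mult_distrib cmod_power2 distrib_left)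
  finally show "(\<integral>z. cis ((sqrt (2 * t) *\<^sub>R Complex (fst z) (snd z)) \<bullet> v) \<partial>std_normal_2d)
           = of_real (exp (- (t * (norm v)\<^sup>2)))" .
qed

section \<open>The Laplace transform of the squared modulus\<close>

definition subset_laplace :: "nat \<Rightarrow> real \<Rightarrow> real" where
  "subset_laplace N t = (\<Sum>A\<in>Pow {1..N-1}. exp (- (t * (norm (normalised_sum N A))\<^sup>2))) / 2 ^ (N - 1)"

lemma
  assumes "t \<ge> 0"
  shows integrable_subset_char:
      "integrable std_normal_2d (\<lambda>z. subset_char N (sqrt (2 * t) *\<^sub>R Complex (fst z) (snd z)))"
    and integral_subset_char:
      "(\<integral>z. subset_char N (sqrt (2 * t) *\<^sub>R Complex (fst z) (snd z)) \<partial>std_normal_2d) = of_real (subset_laplace N t)"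
  unfolding subset_char_def subset_laplace_def
  using std_normal_2d_cis[OF assms] by (simp_all add: integral_sum integrable_sum)

lemma subset_laplace_nonneg: "subset_laplace N t \<ge> 0"
  unfolding subset_laplace_def by (intro divide_nonneg_nonneg sum_nonneg) auto

lemma norm_sqrt_scaleR_Complex:
  "t \<ge> 0 \<Longrightarrow> (norm (sqrt (2 * t) *\<^sub>R Complex x y))\<^sup>2 = 2 * t * (x\<^sup>2 + y\<^sup>2)"
  by (simp add: power_mult_distrib cmod_power2)

lemma subset_laplace_tendsto:
  assumes "t \<ge> 0"
  shows "(\<lambda>N. subset_laplace N t) \<longlonglongrightarrow> 1 / (1 + t)"
proof -
  have "(\<lambda>N. \<integral>z. subset_char N (sqrt (2 * t) *\<^sub>R Complex (fst z) (snd z)) \<partial>std_normal_2d) \<longlonglongrightarrow>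
      (\<integral>z. of_real (exp (- (t * ((fst z)\<^sup>2 + (snd z)\<^sup>2) / 2))) \<partial>std_normal_2d)"
  proof (rule integral_dominated_convergence[where w = "\<lambda>_. 1"])
    show "AE z in std_normal_2d. (\<lambda>N. subset_char N (sqrt (2 * t) *\<^sub>R Complex (fst z) (snd z))) \<longlonglongrightarrow>
        of_real (exp (- (t * ((fst z)\<^sup>2 + (snd z)\<^sup>2) / 2)))"
    proof (rule AE_I2)
      fix z :: "real \<times> real"
      show "(\<lambda>N. subset_char N (sqrt (2 * t) *\<^sub>R Complex (fst z) (snd z))) \<longlonglongrightarrow>
          of_real (exp (- (t * ((fst z)\<^sup>2 + (snd z)\<^sup>2) / 2)))"
        using subset_char_tendsto[of "sqrt (2 * t) *\<^sub>R Complex (fst z) (snd z)"]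
        unfolding norm_sqrt_scaleR_Complex[OF assms] by simp
    qed
  qed (use integrable_subset_char[OF assms] norm_subset_char_le_1 in auto)
  hence "(\<lambda>N. complex_of_real (subset_laplace N t)) \<longlonglongrightarrow> of_real (1 / (1 + t))"
    using assms std_normal_2d_exp_square(2)[of t] integral_subset_char[OF assms] by simp
  thus ?thesis by (simp only: tendsto_of_real_iff)
qed

text \<open>Inside the radius of \<open>norm_subset_char_le\<close> the minimum in its exponent is
  split into two exponentials. Outside it, \<open>t \<le> N^2\<close> forces
  \<open>x^2 + y^2\<close> to be at least \<open>N / 512\<close>, so the trivial bound 1 lies below
  \<open>exp ((x^2 + y^2) / 4 - N / 2048)\<close>, a Chernoff bound with finite Gaussian
  mean.\<close>

lemma norm_subset_char_bound:
  fixes x y t :: real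
  assumes "N \<ge> 3" "0 \<le> t" "t \<le> (real N)\<^sup>2"
  shows "norm (subset_char N (sqrt (2 * t) *\<^sub>R Complex x y)) \<le>
    2 * exp (- ((t / 256) * (x\<^sup>2 + y\<^sup>2) / 2)) + 2 * exp (- (real N / 2048)) +
    exp (- (real N / 2048)) * exp (- ((-1 / 2) * (x\<^sup>2 + y\<^sup>2) / 2))"
proof (cases "norm (sqrt (2 * t) *\<^sub>R Complex x y) \<le> sqrt (real N) * real N / (4 * pi)")
  case True
  define m where "m = (norm (sqrt (2 * t) *\<^sub>R Complex x y))\<^sup>2"
  have m: "m = 2 * t * (x\<^sup>2 + y\<^sup>2)"
    unfolding m_def by (rule norm_sqrt_scaleR_Complex[OF assms(2)])
  have e: "exp (1 / 2 :: real) \<le> 2"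
    by (rule exp_half_le2)
  have "norm (subset_char N (sqrt (2 * t) *\<^sub>R Complex x y)) \<le> exp (1 / 2 - min m (real N) / 1024)"
    unfolding m_def by (rule norm_subset_char_le[OF assms(1) True])
  also have "\<dots> = exp (1 / 2) * exp (- (min m (real N) / 1024))"
    by (simp add: exp_add[symmetric])
  also have "\<dots> \<le> 2 * exp (- (min m (real N) / 1024))"
    using e by (intro mult_right_mono) auto
  also have "\<dots> \<le> 2 * (exp (- (m / 1024)) + exp (- (real N / 1024)))"
    by (auto simp: min_def)
  also have "exp (- (real N / 1024)) \<le> exp (- (real N / 2048))" by simp
  also have "m / 1024 = (t / 256) * (x\<^sup>2 + y\<^sup>2) / 2" by (simp add: m)
  finally have "norm (subset_char N (sqrt (2 * t) *\<^sub>R Complex x y)) \<le>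
      2 * exp (- ((t / 256) * (x\<^sup>2 + y\<^sup>2) / 2)) + 2 * exp (- (real N / 2048))"
    by simp
  moreover have "0 \<le> exp (- (real N / 2048)) * exp (- ((-1 / 2) * (x\<^sup>2 + y\<^sup>2) / 2))" by simp
  ultimately show ?thesis by linarith
next
  case False
  have N: "real N > 0" using assms by simp
  have "(sqrt (real N) * real N / (4 * pi))\<^sup>2 \<le> (norm (sqrt (2 * t) *\<^sub>R Complex x y))\<^sup>2"
    using False by (intro power_mono) auto
  also have "(sqrt (real N) * real N / (4 * pi))\<^sup>2 = real N * (real N)\<^sup>2 / (16 * pi\<^sup>2)"
    by (simp add: power_divide power_mult_distrib)
  finally have "real N ^ 3 / (16 * pi\<^sup>2) \<le> 2 * t * (x\<^sup>2 + y\<^sup>2)"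
    unfolding norm_sqrt_scaleR_Complex[OF assms(2)]
    by (simp add: power3_eq_cube power2_eq_square)
  also have "\<dots> \<le> 2 * (real N)\<^sup>2 * (x\<^sup>2 + y\<^sup>2)"
    using assms by (intro mult_right_mono) auto
  finally have "(real N)\<^sup>2 * (real N / (16 * pi\<^sup>2)) \<le> (real N)\<^sup>2 * (2 * (x\<^sup>2 + y\<^sup>2))"
    by (simp add: power3_eq_cube power2_eq_square mult_ac)
  hence 1: "real N / (16 * pi\<^sup>2) \<le> 2 * (x\<^sup>2 + y\<^sup>2)"
    by (rule mult_left_le_imp_le) (use N in simp)
  have "pi * pi \<le> 4 * 4" using pi_less_4 pi_gt_zero by (intro mult_mono) auto
  hence "real N / (16 * 16) \<le> real N / (16 * pi\<^sup>2)"
    by (intro frac_le) (auto simp: power2_eq_square)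
  with 1 have "real N / 2048 \<le> (x\<^sup>2 + y\<^sup>2) / 4" by simp
  hence "1 \<le> exp (- (real N / 2048) + (x\<^sup>2 + y\<^sup>2) / 4)" by simp
  also have "\<dots> = exp (- (real N / 2048)) * exp (- ((-1 / 2) * (x\<^sup>2 + y\<^sup>2) / 2))"
    unfolding exp_add by simp
  finally have "1 \<le> exp (- (real N / 2048)) * exp (- ((-1 / 2) * (x\<^sup>2 + y\<^sup>2) / 2))" .
  moreover have "0 \<le> 2 * exp (- ((t / 256) * (x\<^sup>2 + y\<^sup>2) / 2)) + 2 * exp (- (real N / 2048))" by simp
  ultimately show ?thesis
    using norm_subset_char_le_1[of N "sqrt (2 * t) *\<^sub>R Complex x y"] by linarith
qed

lemma subset_laplace_le_aux:
  assumes "N \<ge> 3" "0 \<le> t" "t \<le> (real N)\<^sup>2"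
  shows "subset_laplace N t \<le> 2 / (1 + t / 256) + 4 * exp (- (real N / 2048))"
proof -
  define E where "E = exp (- (real N / 2048))"
  let ?c = "\<lambda>z. subset_char N (sqrt (2 * t) *\<^sub>R Complex (fst z) (snd z))"
  let ?g = "\<lambda>a z. exp (- (a * ((fst z)\<^sup>2 + (snd z)\<^sup>2) / 2)) :: real"
  have int: "integrable std_normal_2d (?g (t / 256))" "integrable std_normal_2d (?g (-1 / 2))"
    using assms by (intro std_normal_2d_exp_square(1); simp)+
  have val: "integral\<^sup>L std_normal_2d (?g (t / 256)) = 1 / (1 + t / 256)"
    "integral\<^sup>L std_normal_2d (?g (-1 / 2)) = 2"
    using assms std_normal_2d_exp_square(2)[of "t / 256"] std_normal_2d_exp_square(2)[of "-1 / 2"] by simp_all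
  have intg: "integrable std_normal_2d (\<lambda>z. 2 * ?g (t / 256) z + 2 * E + E * ?g (-1 / 2) z)"
    by (intro Bochner_Integration.integrable_add integrable_mult_right int) auto
  have "subset_laplace N t = norm (integral\<^sup>L std_normal_2d ?c)"
    using integral_subset_char[of t N] assms subset_laplace_nonneg[of N t] by simp
  also have "\<dots> \<le> (\<integral>z. norm (?c z) \<partial>std_normal_2d)"
    by (rule integral_norm_bound)
  also have "\<dots> \<le> (\<integral>z. 2 * ?g (t / 256) z + 2 * E + E * ?g (-1 / 2) z \<partial>std_normal_2d)"
  proof (rule integral_mono)
    show "integrable std_normal_2d (\<lambda>z. norm (?c z))"
      using integrable_subset_char assms by auto
    show "norm (?c z) \<le> 2 * ?g (t / 256) z + 2 * E + E * ?g (-1 / 2) z" for z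
      unfolding E_def by (rule norm_subset_char_bound[OF assms])
  qed (rule intg)
  also have "\<dots> = 2 * (1 / (1 + t / 256)) + 2 * E + E * 2"
    using int val by (simp add: Bochner_Integration.integral_add std_normal_pair.prob_space)
  finally show ?thesis by (simp add: E_def)
qed

lemma subset_laplace_le:
  obtains K where "K > 0" "\<And>N t. N \<ge> 3 \<Longrightarrow> 0 \<le> t \<Longrightarrow> t \<le> (real N)\<^sup>2 \<Longrightarrow> subset_laplace N t \<le> K / (1 + t)"
proof (rule that[of "512 + 16 * 2048\<^sup>2"])
  fix N :: nat and t :: real
  assume N: "N \<ge> 3" and t: "0 \<le> t" "t \<le> (real N)\<^sup>2"
  define x where "x = real N / 2048"
  have x: "x > 0" using N by (simp add: x_def)
  have "2 / (1 + t / 256) = 512 / (256 + t)" using t by (simp add: field_simps)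
  also have "\<dots> \<le> 512 / (1 + t)" using t by (intro frac_le) auto
  finally have 1: "2 / (1 + t / 256) \<le> 512 / (1 + t)" .
  \<comment> \<open>The remainder \<open>exp (- N / 2048)\<close> is absorbed into
    \<open>K / (1 + t)\<close>: it is of order at most \<open>1 / N^2\<close>, and
    \<open>1 + t\<close> is at most \<open>2 * N^2\<close>.\<close>
  have "1 + x + x\<^sup>2 / 2 \<le> exp x" using x by (intro exp_lower_Taylor_quadratic) auto
  hence "x\<^sup>2 / 2 \<le> exp x" using x by linarith
  hence "1 / exp x \<le> 1 / (x\<^sup>2 / 2)"
    using x by (intro frac_le) auto
  hence "exp (- x) \<le> 2 * 2048\<^sup>2 / (real N)\<^sup>2"
    by (simp add: exp_minus inverse_eq_divide x_def power_divide)
  also have "\<dots> \<le> 4 * 2048\<^sup>2 / (1 + t)"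
  proof -
    have "1 \<le> (real N)\<^sup>2" using N by (simp add: one_le_power)
    hence "1 + t \<le> 2 * (real N)\<^sup>2" using t by linarith
    hence "2 * 2048\<^sup>2 * (1 + t) \<le> 2 * 2048\<^sup>2 * (2 * (real N)\<^sup>2)" by simp
    thus ?thesis using N t by (simp add: divide_simps)
  qed
  finally have "4 * exp (- x) \<le> 16 * 2048\<^sup>2 / (1 + t)" by simp
  with 1 subset_laplace_le_aux[OF N t]
  show "subset_laplace N t \<le> (512 + 16 * 2048\<^sup>2) / (1 + t)"
    unfolding x_def add_divide_distrib by linarith
qed simp

section \<open>Moments of a random subset sum\<close>

lemma sum_Pow_insert:
  fixes f :: "'a set \<Rightarrow> 'b :: comm_monoid_add"
  assumes "finite A" "x \<notin> A"
  shows "(\<Sum>X\<in>Pow (insert x A). f X) = (\<Sum>X\<in>Pow A. f X) + (\<Sum>X\<in>Pow A. f (insert x X))"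
proof -
  have "inj_on (insert x) (Pow A)" using assms by (auto simp: inj_on_def)
  hence "(\<Sum>X\<in>insert x ` Pow A. f X) = (\<Sum>X\<in>Pow A. f (insert x X))"
    by (simp add: sum.reindex)
  moreover have "Pow A \<inter> insert x ` Pow A = {}" using assms by auto
  ultimately show ?thesis
    using assms by (simp add: Pow_insert sum.union_disjoint)
qed

text \<open>Mean and second moment are proved together, since adding an element to \<open>S\<close>
  produces a cross term with the mean.\<close>

lemma sum_Pow_norm_squared:
  fixes v :: "'i \<Rightarrow> 'a :: real_inner"
  assumes "finite S"
  shows "2 *\<^sub>R (\<Sum>A\<in>Pow S. \<Sum>i\<in>A. v i) = 2 ^ card S *\<^sub>R (\<Sum>i\<in>S. v i)"
    and "4 * (\<Sum>A\<in>Pow S. (norm (\<Sum>i\<in>A. v i))\<^sup>2) =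
           2 ^ card S * ((norm (\<Sum>i\<in>S. v i))\<^sup>2 + (\<Sum>i\<in>S. (norm (v i))\<^sup>2))"
  using assms
proof (induction S rule: finite_induct)
  case (insert x S)
  have ins: "(\<Sum>i\<in>insert x A. v i) = v x + (\<Sum>i\<in>A. v i)" if "A \<in> Pow S" for A
    using that insert.hyps finite_subset by (subst sum.insert) auto
  have card: "card (Pow S) = 2 ^ card S" using insert.hyps by (simp add: card_Pow)
  define T where "T = (\<Sum>A\<in>Pow S. \<Sum>i\<in>A. v i)"
  define W where "W = (\<Sum>i\<in>S. v i)"
  define c where "c = (2 :: real) ^ card S"
  have T: "2 *\<^sub>R T = c *\<^sub>R W" using insert.IH(1) by (simp add: T_def W_def c_def)
  have "(\<Sum>A\<in>Pow S. \<Sum>i\<in>insert x A. v i) = (\<Sum>A\<in>Pow S. v x + (\<Sum>i\<in>A. v i))"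
    by (intro sum.cong refl ins)
  also have "\<dots> = c *\<^sub>R v x + T"
    by (simp add: sum.distrib card T_def c_def sum_constant_scaleR)
  finally have "2 *\<^sub>R (\<Sum>A\<in>Pow (insert x S). \<Sum>i\<in>A. v i) = 2 *\<^sub>R T + 2 *\<^sub>R T + (2 * c) *\<^sub>R v x"
    using insert.hyps by (simp add: sum_Pow_insert T_def scaleR_add_right flip: scaleR_2)
  also have "\<dots> = (2 * c) *\<^sub>R (v x + W)"
    unfolding T by (simp add: scaleR_add_right flip: scaleR_2)
  finally show "2 *\<^sub>R (\<Sum>A\<in>Pow (insert x S). \<Sum>i\<in>A. v i) = 2 ^ card (insert x S) *\<^sub>R (\<Sum>i\<in>insert x S. v i)"
    using insert.hyps by (simp add: c_def W_def)
  define Q where "Q = (\<Sum>A\<in>Pow S. (norm (\<Sum>i\<in>A. v i))\<^sup>2)"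
  define R where "R = (\<Sum>i\<in>S. (norm (v i))\<^sup>2)"
  have Q: "4 * Q = c * ((norm W)\<^sup>2 + R)" using insert.IH(2) by (simp add: Q_def R_def W_def c_def)
  have sq: "(norm (a + b))\<^sup>2 = (norm a)\<^sup>2 + 2 * (a \<bullet> b) + (norm b)\<^sup>2" for a b :: 'a
    by (simp add: power2_norm_eq_inner inner_add_left inner_add_right inner_commute)
  have "(\<Sum>A\<in>Pow S. (norm (\<Sum>i\<in>insert x A. v i))\<^sup>2) = (\<Sum>A\<in>Pow S. (norm (v x))\<^sup>2 + 2 * (v x \<bullet> (\<Sum>i\<in>A. v i)) + (norm (\<Sum>i\<in>A. v i))\<^sup>2)"
    by (intro sum.cong refl) (simp add: ins sq)
  also have "\<dots> = c * (norm (v x))\<^sup>2 + v x \<bullet> (2 *\<^sub>R T) + Q"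
    by (simp add: sum.distrib card T_def Q_def c_def sum_distrib_left[symmetric] inner_sum_right[symmetric])
  finally have "4 * (\<Sum>A\<in>Pow (insert x S). (norm (\<Sum>i\<in>A. v i))\<^sup>2) = 4 * Q + 4 * (c * (norm (v x))\<^sup>2 + v x \<bullet> (c *\<^sub>R W) + Q)"
    using insert.hyps by (simp add: sum_Pow_insert Q_def T)
  also have "\<dots> = 2 * c * ((norm (v x + W))\<^sup>2 + ((norm (v x))\<^sup>2 + R))"
    unfolding sq using Q by (simp add: algebra_simps)
  finally show "4 * (\<Sum>A\<in>Pow (insert x S). (norm (\<Sum>i\<in>A. v i))\<^sup>2) =
      2 ^ card (insert x S) * ((norm (\<Sum>i\<in>insert x S. v i))\<^sup>2 + (\<Sum>i\<in>insert x S. (norm (v i))\<^sup>2))"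
    using insert.hyps by (simp add: c_def W_def R_def)
qed simp_all

text \<open>Exact, not only asymptotic: the full sum is -1 and contributes 1 beside the
  \<open>N - 1\<close> unit vectors, in total \<open>N\<close>.\<close>

lemma sum_normalised_sum_norm_squared:
  assumes "N \<ge> 2"
  shows "(\<Sum>A\<in>Pow {1..N-1}. (norm (normalised_sum N A))\<^sup>2) = 2 ^ (N - 1)"
proof -
  have "(norm (normalised_sum N A))\<^sup>2 = 4 / real N * (norm (\<Sum>i\<in>A. zeta N ^ i))\<^sup>2" for A
    by (simp add: normalised_sum_def power_mult_distrib power_divide)
  hence "(\<Sum>A\<in>Pow {1..N-1}. (norm (normalised_sum N A))\<^sup>2) =
      (4 * (\<Sum>A\<in>Pow {1..N-1}. (norm (\<Sum>i\<in>A. zeta N ^ i))\<^sup>2)) / real N"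
    by (simp add: sum_distrib_left sum_divide_distrib)
  also have "\<dots> = 2 ^ (N - 1)"
    unfolding sum_Pow_norm_squared(2)[OF finite_atLeastAtMost] sum_zeta_power_nonzero[OF assms]
    using assms by (simp add: of_nat_diff)
  finally show ?thesis .
qed

section \<open>The mean of the logarithm\<close>

text \<open>The averaged numerator of Frullani's formula. The empty set is dropped since its sum is
  0 and has no logarithm, but the divisor stays \<open>2 ^ (N - 1)\<close> as in
  \<open>subset_laplace\<close>; the formula for the expectation corrects for this.\<close>

definition laplace_gap :: "nat \<Rightarrow> real \<Rightarrow> real" where
  "laplace_gap N t =
     (\<Sum>A\<in>Pow {1..N-1} - {{}}. exp (- t) - exp (- t * (norm (normalised_sum N A))\<^sup>2)) / 2 ^ (N - 1)"

lemma laplace_gap_eq: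
  "laplace_gap N t = (1 - 1 / 2 ^ (N - 1)) * exp (- t) - (subset_laplace N t - 1 / 2 ^ (N - 1))"
proof -
  have "(\<Sum>A\<in>Pow {1..N-1} - {{}}. exp (- t * (norm (normalised_sum N A))\<^sup>2)) =
      (\<Sum>A\<in>Pow {1..N-1}. exp (- (t * (norm (normalised_sum N A))\<^sup>2))) - 1"
    by (subst sum_diff1) (auto simp: normalised_sum_def)
  moreover have "real (card (Pow {1..N-1} - {{}})) = 2 ^ (N - 1) - 1"
    by (subst card_Diff_singleton) (auto simp: card_Pow of_nat_diff)
  ultimately show ?thesis
    by (simp add: laplace_gap_def subset_laplace_def sum_subtractf diff_divide_distrib
        left_diff_distrib)
qed

lemma abs_exp_minus_diff_le:
  fixes a b :: real
  assumes "0 \<le> a" "0 \<le> b"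
  shows "\<bar>exp (- a) - exp (- b)\<bar> \<le> \<bar>a - b\<bar>"
proof -
  have "exp (- a) - exp (- b) \<le> b - a" if "0 \<le> a" "a \<le> b" for a b :: real
  proof -
    have "exp (- a) - exp (- b) = exp (- a) * (1 - exp (- (b - a)))"
      by (simp add: right_diff_distrib exp_add[symmetric])
    also have "1 - exp (- (b - a)) \<le> b - a"
      using exp_ge_add_one_self[of "- (b - a)"] by linarith
    also have "exp (- a) * (b - a) \<le> 1 * (b - a)"
      using that by (intro mult_right_mono) auto
    finally show ?thesis by simp
  qed
  from this[of a b] this[of b a] assms show ?thesis by (cases "a \<le> b") auto
qed

text \<open>The decay bound for \<open>subset_laplace\<close> does not show vanishing at 0. The
  linear bound comes from the Lipschitz property of the exponential, 2 being the mean of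
  \<open>1 + Y\<close>.\<close>

lemma abs_laplace_gap_le_small:
  assumes "N \<ge> 2" "0 \<le> t"
  shows "\<bar>laplace_gap N t\<bar> \<le> 2 * t"
proof -
  let ?Y = "\<lambda>A. (norm (normalised_sum N A))\<^sup>2"
  have "\<bar>\<Sum>A\<in>Pow {1..N-1} - {{}}. exp (- t) - exp (- t * ?Y A)\<bar>
      \<le> (\<Sum>A\<in>Pow {1..N-1} - {{}}. \<bar>exp (- t) - exp (- t * ?Y A)\<bar>)"
    by (rule sum_abs)
  also have "\<dots> \<le> (\<Sum>A\<in>Pow {1..N-1} - {{}}. t * (1 + ?Y A))"
  proof (intro sum_mono)
    fix A
    have "\<bar>exp (- t) - exp (- (t * ?Y A))\<bar> \<le> \<bar>t - t * ?Y A\<bar>"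
      using assms by (intro abs_exp_minus_diff_le) auto
    also have "t - t * ?Y A = t * (1 - ?Y A)" by (simp add: algebra_simps)
    also have "\<bar>\<dots>\<bar> \<le> t * (1 + ?Y A)"
      using assms zero_le_power2[of "norm (normalised_sum N A)"]
      unfolding abs_mult by (intro mult_mono) (auto simp: abs_le_iff)
    finally show "\<bar>exp (- t) - exp (- t * ?Y A)\<bar> \<le> t * (1 + ?Y A)" by simp
  qed
  also have "\<dots> \<le> (\<Sum>A\<in>Pow {1..N-1}. t * (1 + ?Y A))"
    using assms by (intro sum_mono2) auto
  also have "\<dots> = 2 * t * 2 ^ (N - 1)"
    using sum_normalised_sum_norm_squared[OF assms(1)]
    by (simp add: sum_distrib_left[symmetric] sum.distrib card_Pow)
  finally show ?thesis
    by (simp add: laplace_gap_def abs_divide divide_le_eq)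
qed

lemma laplace_gap_integral_tendsto:
  "(\<lambda>N. integral {0..(real N)\<^sup>2} (\<lambda>t. laplace_gap N t / t)) \<longlonglongrightarrow> - euler_mascheroni"
proof -
  obtain K where K: "K > 0"
    "\<And>N t. N \<ge> 3 \<Longrightarrow> 0 \<le> t \<Longrightarrow> t \<le> (real N)\<^sup>2 \<Longrightarrow> subset_laplace N t \<le> K / (1 + t)"
    by (rule subset_laplace_le) blast
  \<comment> \<open>The index shift by 3 puts every \<open>N\<close> in the range of the bounds, and
    extension by 0 gives all integrands one domain.\<close>
  define f where "f = (\<lambda>N t. if t \<in> {0..(real (N + 3))\<^sup>2} then laplace_gap (N + 3) t / t else 0)"
  \<comment> \<open>The summand 4 serves \<open>t \<le> 1\<close>, where the quotient is at most 2;
    \<open>2 * (K + 1)\<close> serves larger \<open>t\<close>.\<close>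
  define C where "C = 4 + 2 * (K + 1)"
  have int: "f N integrable_on {0..}" for N
  proof -
    have "(\<lambda>t. \<Sum>A\<in>Pow {1..N+3-1} - {{}}.
        (exp (- t * 1) - exp (- t * (norm (normalised_sum (N + 3) A))\<^sup>2)) / t / 2 ^ (N + 3 - 1))
      integrable_on {0..(real (N + 3))\<^sup>2}"
      by (intro integrable_sum integrable_on_divide frullani_integrable) auto
    moreover have "(\<lambda>t. \<Sum>A\<in>Pow {1..N+3-1} - {{}}.
        (exp (- t * 1) - exp (- t * (norm (normalised_sum (N + 3) A))\<^sup>2)) / t / 2 ^ (N + 3 - 1)) =
        (\<lambda>t. laplace_gap (N + 3) t / t)"
      unfolding laplace_gap_def sum_divide_distrib by (simp add: mult.commute)
    ultimately have "(\<lambda>t. laplace_gap (N + 3) t / t) integrable_on {0..(real (N + 3))\<^sup>2}"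
      by simp
    thus ?thesis
      unfolding f_def by (subst integrable_restrict_Int) (simp add: Int_absorb1)
  qed
  have bound: "norm (f N t) \<le> C / (1 + t\<^sup>2)" if t: "t \<in> {0..}" for N t
  proof (cases "0 < t \<and> t \<le> (real (N + 3))\<^sup>2")
    case True
    hence f: "norm (f N t) = \<bar>laplace_gap (N + 3) t\<bar> / t"
      by (simp add: f_def abs_divide)
    show ?thesis
    proof (cases "t \<le> 1")
      case T: True
      have "norm (f N t) \<le> 2 * t / t"
        unfolding f using True by (intro divide_right_mono abs_laplace_gap_le_small) auto
      also have "\<dots> = 2" using True by simp
      also have "2 \<le> C / (1 + t\<^sup>2)"
      proof (rule mult_imp_le_div_pos)
        have "t * t \<le> 1 * 1" using T True by (intro mult_mono) auto
        thus "2 * (1 + t\<^sup>2) \<le> C" using K(1) by (simp add: C_def power2_eq_square)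
      qed (simp add: add_pos_nonneg)
      finally show ?thesis .
    next
      case False
      define M where "M = (2 :: real) ^ (N + 3 - 1)"
      have M: "M \<ge> 1" unfolding M_def by (rule one_le_power) simp
      \<comment> \<open>The empty set alone contributes \<open>1 / M\<close>, so removing it in
        \<open>laplace_gap_eq\<close> leaves a nonnegative quantity.\<close>
      have L: "subset_laplace (N + 3) t \<le> K / (1 + t)" "subset_laplace (N + 3) t \<ge> 1 / M"
      proof -
        show "subset_laplace (N + 3) t \<le> K / (1 + t)"
          using True by (intro K(2)) auto
        have "exp (- (t * (norm (normalised_sum (N + 3) {}))\<^sup>2)) \<le>
          (\<Sum>A\<in>Pow {1..N+3-1}. exp (- (t * (norm (normalised_sum (N + 3) A))\<^sup>2)))"
          by (intro member_le_sum) auto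
        thus "subset_laplace (N + 3) t \<ge> 1 / M"
          unfolding subset_laplace_def M_def by (intro divide_right_mono) (auto simp: normalised_sum_def)
      qed
      have e: "exp (- t) \<le> 1 / (1 + t)"
        using exp_ge_add_one_self[of t] True by (simp add: exp_minus field_simps)
      have "laplace_gap (N + 3) t = (1 - 1 / M) * exp (- t) - (subset_laplace (N + 3) t - 1 / M)"
        by (simp add: laplace_gap_eq M_def)
      moreover have "0 \<le> (1 - 1 / M) * exp (- t)" using M by simp
      moreover have "(1 - 1 / M) * exp (- t) \<le> 1 * exp (- t)"
        using M by (intro mult_right_mono) auto
      moreover have "0 \<le> 1 / M" using M by simp
      ultimately have "\<bar>laplace_gap (N + 3) t\<bar> \<le> 1 / (1 + t) + K / (1 + t)"
        using L e K(1) True by (smt (verit) divide_nonneg_nonneg)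
      also have "\<dots> = (K + 1) / (1 + t)" by (simp add: add_divide_distrib)
      finally have "norm (f N t) \<le> (K + 1) / (1 + t) / t"
        unfolding f using True by (intro divide_right_mono) auto
      also have "\<dots> = 2 * (K + 1) / (2 * (t * (1 + t)))"
        by (simp only: mult_divide_mult_cancel_left_if divide_divide_eq_left) (simp add: mult.commute)
      also have "\<dots> \<le> C / (1 + t\<^sup>2)"
      proof (rule frac_le)
        have "1 * 1 \<le> t * t" using False by (intro mult_mono) auto
        thus "1 + t\<^sup>2 \<le> 2 * (t * (1 + t))" using False by (simp add: power2_eq_square algebra_simps)
      qed (use K(1) in \<open>auto simp: C_def add_pos_nonneg\<close>)
      finally show ?thesis .
    qed
  next
    case False
    have "0 \<le> C / (1 + t\<^sup>2)" using K(1) by (simp add: C_def)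
    moreover have "f N t = 0" using False t by (auto simp: f_def)
    ultimately show ?thesis by simp
  qed
  have lim: "(\<lambda>N. f N t) \<longlonglongrightarrow> (exp (- t) - 1 / (1 + t)) / t" if t: "t \<in> {0..}" for t
  proof (cases "t = 0")
    case False
    have "(\<lambda>N. (1 / 2) ^ N :: real) \<longlonglongrightarrow> 0" by (rule LIMSEQ_power_zero) simp
    hence "(\<lambda>N. (1 / 2) ^ (N + 2) :: real) \<longlonglongrightarrow> 0" by (rule LIMSEQ_ignore_initial_segment)
    hence M: "(\<lambda>N. 1 / 2 ^ (N + 3 - 1) :: real) \<longlonglongrightarrow> 0" by (simp add: power_one_over)
    have L: "(\<lambda>N. subset_laplace (N + 3) t) \<longlonglongrightarrow> 1 / (1 + t)"
      using t by (intro LIMSEQ_ignore_initial_segment subset_laplace_tendsto) auto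
    have "(\<lambda>N. laplace_gap (N + 3) t / t) \<longlonglongrightarrow> ((1 - 0) * exp (- t) - (1 / (1 + t) - 0)) / t"
      unfolding laplace_gap_eq by (intro tendsto_intros M L False)
    moreover have "eventually (\<lambda>N. f N t = laplace_gap (N + 3) t / t) sequentially"
      using eventually_ge_at_top[of "nat \<lceil>t\<rceil>"]
    proof eventually_elim
      case (elim N)
      hence "t \<le> real N" by (simp add: nat_ceiling_le_eq)
      also have "\<dots> \<le> real (N + 3) ^ 1" by simp
      also have "\<dots> \<le> (real (N + 3))\<^sup>2" by (intro power_increasing) auto
      finally show ?case using t by (simp add: f_def)
    qed
    ultimately show ?thesis using tendsto_cong by force
  qed (simp add: f_def)
  have "(\<lambda>N. integral {0..} (f N)) \<longlonglongrightarrow> integral {0..} (\<lambda>t. (exp (- t) - 1 / (1 + t)) / t)"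
    by (rule dominated_convergence(2)[OF int integrable_on_inverse_1_plus_square[of C]])
       (use bound lim in auto)
  moreover have "integral {0..} (f N) = integral {0..(real (N + 3))\<^sup>2} (\<lambda>t. laplace_gap (N + 3) t / t)" for N
    unfolding f_def by (subst integral_restrict_Int) (simp add: Int_absorb1)
  ultimately have "(\<lambda>N. integral {0..(real (N + 3))\<^sup>2} (\<lambda>t. laplace_gap (N + 3) t / t)) \<longlonglongrightarrow> - euler_mascheroni"
    using integral_unique[OF euler_mascheroni_integral] by simp
  thus ?thesis by (rule LIMSEQ_offset)
qed

definition mean_log_square :: "nat \<Rightarrow> real" where
  "mean_log_square N = (\<Sum>A\<in>Pow {1..N-1} - {{}}. ln ((norm (normalised_sum N A))\<^sup>2)) / 2 ^ (N - 1)"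

text \<open>For \<open>Y \<le> 1\<close> the truncation error is \<open>exp (- T * Y)\<close> times
  a logarithm bounded through \<open>lb\<close>, and averaging the exponential gives
  \<open>subset_laplace N T\<close>. For \<open>Y > 1\<close> the logarithm is below
  \<open>Y\<close>, whose mean over all subsets is 1, leaving \<open>exp (- T)\<close>.\<close>

lemma mean_log_square_approx:
  assumes N: "N \<ge> 2" and lb: "\<And>A. A \<subseteq> {1..N-1} \<Longrightarrow> A \<noteq> {} \<Longrightarrow> 1 \<le> norm (\<Sum>i\<in>A. zeta N ^ i) * real N ^ N"
    and T: "T \<ge> 0"
  shows "\<bar>integral {0..T} (\<lambda>t. laplace_gap N t / t) - mean_log_square N\<bar> \<le>
           subset_laplace N T * (4 * real N * ln (real N)) + exp (- T)"
proof -
  let ?Y = "\<lambda>A. (norm (normalised_sum N A))\<^sup>2"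
  let ?S = "Pow {1..N-1} - {{}}"
  \<comment> \<open>With \<open>Y = 4 * x^2 / N\<close> and \<open>x\<close> at least
    \<open>1 / N ^ N\<close>, minus the logarithm is at most \<open>(2 * N + 1) * ln N\<close>; the
    factor 4 is a round bound.\<close>
  define B where "B = 4 * real N * ln (real N)"
  have B: "B \<ge> 0" using N by (simp add: B_def)
  have Y: "?Y A > 0" "- ln (?Y A) \<le> B" if "A \<in> ?S" for A
  proof -
    define x where "x = norm (\<Sum>i\<in>A. zeta N ^ i)"
    have x: "1 \<le> x * real N ^ N" unfolding x_def using that by (intro lb) auto
    hence x0: "x > 0"
      by (smt (verit) mult_nonpos_nonneg of_nat_0_le_iff zero_le_power)
    have Yx: "?Y A = 4 * x\<^sup>2 / real N"
      by (simp add: normalised_sum_def x_def power_mult_distrib power_divide)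
    show "?Y A > 0" using x0 N by (simp add: Yx)
    have "0 \<le> ln (x * real N ^ N)" using x by simp
    hence "0 \<le> ln x + real N * ln (real N)"
      using x0 N by (simp add: ln_mult ln_realpow)
    moreover have "ln (?Y A) = ln 4 + 2 * ln x - ln (real N)"
      using x0 N by (simp add: Yx ln_mult ln_div ln_realpow)
    moreover have "ln (4 :: real) \<ge> 0" by simp
    moreover have "1 * ln (real N) \<le> real N * ln (real N)"
      using N by (intro mult_right_mono) auto
    moreover have "0 \<le> real N * ln (real N)" using N by simp
    moreover have "B = 4 * (real N * ln (real N))" by (simp add: B_def)
    ultimately show "- ln (?Y A) \<le> B" by linarith
  qed
  define h where "h = (\<lambda>A. integral {0..T} (\<lambda>t. (exp (- t) - exp (- t * ?Y A)) / t))"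
  have h: "((\<lambda>t. (exp (- t) - exp (- t * ?Y A)) / t) has_integral h A) {0..T}"
    "\<bar>h A - ln (?Y A)\<bar> \<le> exp (- (T * ?Y A)) * B + exp (- T) * ?Y A" if A: "A \<in> ?S" for A
  proof -
    obtain u where u: "((\<lambda>t. (exp (- t) - exp (- t * ?Y A)) / t) has_integral u) {0..T}"
      "\<bar>u - ln (?Y A)\<bar> \<le> exp (- T * min 1 (?Y A)) * \<bar>ln (?Y A)\<bar>"
      by (rule frullani_truncated[OF Y(1)[OF A] T])
    have "u = h A" unfolding h_def using u(1) by (simp add: integral_unique)
    with u(1) show "((\<lambda>t. (exp (- t) - exp (- t * ?Y A)) / t) has_integral h A) {0..T}" by simp
    have "exp (- T * min 1 (?Y A)) * \<bar>ln (?Y A)\<bar> \<le> exp (- (T * ?Y A)) * B + exp (- T) * ?Y A"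
    proof (cases "?Y A \<le> 1")
      case True
      have "ln (?Y A) \<le> 0" using True Y(1)[OF A] by (subst ln_le_zero_iff)
      hence "\<bar>ln (?Y A)\<bar> \<le> B" using Y(2)[OF A] by linarith
      hence "exp (- T * min 1 (?Y A)) * \<bar>ln (?Y A)\<bar> \<le> exp (- (T * ?Y A)) * B"
        using True by (simp add: min_absorb2)
      thus ?thesis using Y(1)[OF A] by (smt (verit) exp_gt_zero mult_nonneg_nonneg)
    next
      case False
      have "ln (?Y A) \<le> ?Y A - 1" using Y(1)[OF A] by (rule ln_le_minus_one)
      moreover have "0 \<le> ln (?Y A)" using False by (intro ln_ge_zero) simp
      ultimately have "\<bar>ln (?Y A)\<bar> \<le> ?Y A" by linarith
      hence "exp (- T * min 1 (?Y A)) * \<bar>ln (?Y A)\<bar> \<le> exp (- T) * ?Y A"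
        using False by (simp add: min_absorb1)
      moreover have "0 \<le> exp (- (T * ?Y A)) * B" using B by simp
      ultimately show ?thesis by linarith
    qed
    with u(2) \<open>u = h A\<close> show "\<bar>h A - ln (?Y A)\<bar> \<le> exp (- (T * ?Y A)) * B + exp (- T) * ?Y A"
      by linarith
  qed
  have "((\<lambda>t. (\<Sum>A\<in>?S. (exp (- t) - exp (- t * ?Y A)) / t) / 2 ^ (N - 1)) has_integral
      (\<Sum>A\<in>?S. h A) / 2 ^ (N - 1)) {0..T}"
    by (intro has_integral_divide has_integral_sum h(1)) auto
  moreover have "(\<Sum>A\<in>?S. (exp (- t) - exp (- t * ?Y A)) / t) / 2 ^ (N - 1) = laplace_gap N t / t" for t
    unfolding laplace_gap_def by (simp add: sum_divide_distrib[symmetric])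
  ultimately have "((\<lambda>t. laplace_gap N t / t) has_integral (\<Sum>A\<in>?S. h A) / 2 ^ (N - 1)) {0..T}"
    by simp
  hence "integral {0..T} (\<lambda>t. laplace_gap N t / t) - mean_log_square N =
      (\<Sum>A\<in>?S. h A - ln (?Y A)) / 2 ^ (N - 1)"
    by (simp add: integral_unique mean_log_square_def sum_subtractf diff_divide_distrib)
  also have "\<bar>\<dots>\<bar> \<le> (\<Sum>A\<in>?S. exp (- (T * ?Y A)) * B + exp (- T) * ?Y A) / 2 ^ (N - 1)"
    unfolding abs_divide by (intro frac_le order_trans[OF sum_abs] sum_mono h(2)) (auto intro!: sum_nonneg add_nonneg_nonneg mult_nonneg_nonneg B)
  also have "\<dots> \<le> (\<Sum>A\<in>Pow {1..N-1}. exp (- (T * ?Y A)) * B + exp (- T) * ?Y A) / 2 ^ (N - 1)"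
    by (intro divide_right_mono sum_mono2) (auto simp: B)
  also have "(\<Sum>A\<in>Pow {1..N-1}. exp (- (T * ?Y A)) * B + exp (- T) * ?Y A) =
      (\<Sum>A\<in>Pow {1..N-1}. exp (- (T * ?Y A))) * B + exp (- T) * 2 ^ (N - 1)"
    using sum_normalised_sum_norm_squared[OF N]
    by (simp add: sum.distrib sum_distrib_right sum_distrib_left[symmetric])
  also have "\<dots> / 2 ^ (N - 1) = subset_laplace N T * B + exp (- T)"
    by (simp add: subset_laplace_def add_divide_distrib)
  finally show ?thesis by (simp add: B_def)
qed

text \<open>The analytic limits run over all \<open>N\<close>, but the lower bound is available only
  along primes: for composite \<open>N\<close> a nonempty subset can sum to 0. Hence the general
  filter. At cutoff \<open>N^2\<close> the error is of order \<open>ln N / N\<close>.\<close>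

lemma mean_log_square_tendsto:
  assumes "F \<le> sequentially"
    and "eventually (\<lambda>N. \<forall>A. A \<subseteq> {1..N-1} \<longrightarrow> A \<noteq> {} \<longrightarrow> 1 \<le> norm (\<Sum>i\<in>A. zeta N ^ i) * real N ^ N) F"
  shows "(mean_log_square \<longlongrightarrow> - euler_mascheroni) F"
proof -
  obtain K where K: "K > 0"
    "\<And>N t. N \<ge> 3 \<Longrightarrow> 0 \<le> t \<Longrightarrow> t \<le> (real N)\<^sup>2 \<Longrightarrow> subset_laplace N t \<le> K / (1 + t)"
    by (rule subset_laplace_le) blast
  define J where "J = (\<lambda>N. integral {0..(real N)\<^sup>2} (\<lambda>t. laplace_gap N t / t))"
  define E where "E = (\<lambda>N. K / (1 + (real N)\<^sup>2) * (4 * real N * ln (real N)) + exp (- ((real N)\<^sup>2)))"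
  have "E \<longlonglongrightarrow> 0" unfolding E_def by real_asymp
  hence E: "(E \<longlongrightarrow> 0) F" using assms(1) by (rule tendsto_mono[rotated])
  have J: "(J \<longlongrightarrow> - euler_mascheroni) F"
    unfolding J_def using laplace_gap_integral_tendsto assms(1) by (rule tendsto_mono[rotated])
  have "((\<lambda>N. mean_log_square N - J N) \<longlongrightarrow> 0) F"
  proof (rule Lim_null_comparison[OF _ E])
    have "eventually (\<lambda>N. N \<ge> 3) F" using assms(1) eventually_ge_at_top[of 3] filter_leD by blast
    with assms(2) show "eventually (\<lambda>N. norm (mean_log_square N - J N) \<le> E N) F"
    proof eventually_elim
      case (elim N)
      have "\<bar>J N - mean_log_square N\<bar> \<le> subset_laplace N ((real N)\<^sup>2) * (4 * real N * ln (real N)) + exp (- ((real N)\<^sup>2))"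
        unfolding J_def using elim by (intro mean_log_square_approx) auto
      also have "subset_laplace N ((real N)\<^sup>2) \<le> K / (1 + (real N)\<^sup>2)"
        using elim by (intro K(2)) auto
      finally show ?case
        using elim by (simp add: E_def mult_right_mono abs_minus_commute)
    qed
  qed
  from tendsto_add[OF this J] show ?thesis by simp
qed

section \<open>Arithmetic of prime cyclotomic integers\<close>

definition ipoly :: "int poly \<Rightarrow> complex \<Rightarrow> complex" where
  "ipoly P z = poly (map_poly of_int P) z"

lemma ipoly_0 [simp]: "ipoly 0 z = 0"
  by (simp add: ipoly_def)

lemma ipoly_pCons [simp]: "ipoly (pCons a P) z = of_int a + z * ipoly P z"
  by (simp add: ipoly_def map_poly_pCons)

lemma ipoly_add [simp]: "ipoly (P + Q) z = ipoly P z + ipoly Q z"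
  by (induction P Q rule: poly_induct2) (simp_all add: algebra_simps)

lemma ipoly_smult [simp]: "ipoly (smult a P) z = of_int a * ipoly P z"
  by (induction P) (simp_all add: algebra_simps)

lemma ipoly_mult [simp]: "ipoly (P * Q) z = ipoly P z * ipoly Q z"
  by (induction P) (simp_all add: algebra_simps)

lemma ipoly_1 [simp]: "ipoly 1 z = 1"
  by (simp add: one_pCons)

lemma ipoly_uminus [simp]: "ipoly (- P) z = - ipoly P z"
  by (induction P) (simp_all add: algebra_simps)

lemma ipoly_diff [simp]: "ipoly (P - Q) z = ipoly P z - ipoly Q z"
  using ipoly_add[of P "- Q" z] by simp

lemma ipoly_monom [simp]: "ipoly (monom a n) z = of_int a * z ^ n"
  by (induction n) (simp_all add: monom_0 monom_Suc algebra_simps)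

lemma ipoly_sum [simp]: "ipoly (\<Sum>i\<in>A. f i) z = (\<Sum>i\<in>A. ipoly (f i) z)"
  by (induction A rule: infinite_finite_induct) simp_all

lemma ipoly_prod [simp]: "ipoly (\<Prod>i\<in>A. f i) z = (\<Prod>i\<in>A. ipoly (f i) z)"
  by (induction A rule: infinite_finite_induct) simp_all

lemma ipoly_pcompose [simp]: "ipoly (pcompose P Q) z = ipoly P (ipoly Q z)"
  by (induction P) (simp_all add: pcompose_pCons)

lemma ipoly_of_int: "ipoly P (of_int k) = of_int (poly P k)"
  by (induction P) simp_all

lemma cyclotomic_ring_eq: "cyclotomic_ring N = range (\<lambda>P. ipoly P (zeta N))"
  by (simp add: cyclotomic_ring_def ipoly_def)

section \<open>Exponents modulo a prime\<close>

lemma zeta_power_mod: "N > 0 \<Longrightarrow> zeta N ^ (k mod N) = zeta N ^ k"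
proof -
  assume "N > 0"
  have "zeta N ^ k = zeta N ^ (N * (k div N) + k mod N)" by simp
  also have "\<dots> = (zeta N ^ N) ^ (k div N) * zeta N ^ (k mod N)"
    by (simp only: power_add power_mult)
  finally show ?thesis using zeta_power_eq_1_iff[OF \<open>N > 0\<close>, of N] by simp
qed

lemma bij_betw_mult_mod_prime:
  assumes "prime N" "m \<in> {1..N-1}"
  shows "bij_betw (\<lambda>j. m * j mod N) {1..N-1} {1..N-1 :: nat}"
proof -
  have N: "N > 1" using assms(1) prime_gt_1_nat by blast
  have m: "\<not> N dvd m" using assms(2) N by (auto dest: dvd_imp_le)
  hence cop: "coprime m N" using assms(1) by (metis coprime_commute prime_imp_coprime)
  have inj: "inj_on (\<lambda>j. m * j mod N) {1..N-1}"
  proof (rule inj_onI)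
    fix i j assume ij: "i \<in> {1..N-1}" "j \<in> {1..N-1}" "m * i mod N = m * j mod N"
    have "[m * i = m * j] (mod N)" using ij(3) by (simp add: cong_def)
    hence "[i = j] (mod N)" using cong_mult_lcancel_nat[OF cop] by blast
    moreover have "i < N" "j < N" using ij(1,2) N by auto
    ultimately show "i = j" by (simp add: cong_def)
  qed
  have "(\<lambda>j. m * j mod N) ` {1..N-1} \<subseteq> {1..N-1}"
  proof safe
    fix j assume j: "j \<in> {1..N-1}"
    have "\<not> N dvd j" using j N by (auto dest: dvd_imp_le)
    hence "\<not> N dvd m * j" using m assms(1) by (simp add: prime_dvd_mult_iff)
    hence "m * j mod N \<noteq> 0" by (simp add: dvd_eq_mod_eq_0)
    moreover have "m * j mod N < N" using N by simp
    ultimately show "m * j mod N \<in> {1..N-1}" by auto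
  qed
  with inj show ?thesis
    by (simp add: bij_betw_def endo_inj_surj)
qed

lemma prime_inverse_mod:
  assumes "prime N" "m \<in> {1..N-1}"
  obtains j where "j \<in> {1..N-1}" "m * j mod N = (1 :: nat)"
proof -
  have "N > 1" using assms(1) prime_gt_1_nat by blast
  hence "1 \<in> (\<lambda>j. m * j mod N) ` {1..N-1}"
    using bij_betw_imp_surj_on[OF bij_betw_mult_mod_prime[OF assms]] by simp
  thus ?thesis using that by auto
qed

text \<open>Each power \<open>X ^ n\<close> sums to \<open>N\<close> or 0 over the
  \<open>N\<close>-th roots of unity, so \<open>k\<close> is the sum of the coefficients at
  exponents divisible by \<open>N\<close>.\<close>

lemma sum_ipoly_zeta_power:
  assumes "N > 0"
  obtains k :: int where "(\<Sum>j<N. ipoly P (zeta N ^ j)) = of_nat N * of_int k"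
proof -
  \<comment> \<open>The twist \<open>zeta N ^ (j * n)\<close> records the power of \<open>X\<close>
    split off so far by the induction on coefficients.\<close>
  have "\<exists>k :: int. (\<Sum>j<N. zeta N ^ (j * n) * ipoly P (zeta N ^ j)) = of_nat N * of_int k" for n
  proof (induction P arbitrary: n)
    case (pCons a P)
    obtain k :: int where k: "(\<Sum>j<N. zeta N ^ (j * Suc n) * ipoly P (zeta N ^ j)) = of_nat N * of_int k"
      using pCons by blast
    have "(\<Sum>j<N. zeta N ^ (j * n) * ipoly (pCons a P) (zeta N ^ j)) =
        (\<Sum>j<N. of_int a * zeta N ^ (j * n) + zeta N ^ (j * Suc n) * ipoly P (zeta N ^ j))"
      by (intro sum.cong refl) (simp add: power_add algebra_simps)
    also have "\<dots> = of_int a * (if N dvd n then of_nat N else 0) + of_nat N * of_int k"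
      by (simp only: sum.distrib sum_distrib_left[symmetric] sum_zeta_power[OF assms] k)
    also have "\<dots> = of_nat N * of_int ((if N dvd n then a else 0) + k)"
      by (simp add: algebra_simps)
    finally show ?case by blast
  qed (auto intro: exI[of _ 0])
  from this[of 0] show ?thesis using that by auto
qed

text \<open>For prime \<open>N\<close> its value at every nontrivial root of unity is the same, the
  norm of the element represented by \<open>P\<close>, because raising to the power \<open>m\<close>
  only permutes the factors.\<close>

definition norm_poly :: "nat \<Rightarrow> int poly \<Rightarrow> int poly" where
  "norm_poly N P = (\<Prod>j=1..N-1. pcompose P (monom 1 j))"

lemma ipoly_norm_poly: "ipoly (norm_poly N P) z = (\<Prod>j=1..N-1. ipoly P (z ^ j))"
  by (simp add: norm_poly_def)

lemma ipoly_norm_poly_zeta_power: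
  assumes "prime N" "m \<in> {1..N-1}"
  shows "ipoly (norm_poly N P) (zeta N ^ m) = (\<Prod>j=1..N-1. ipoly P (zeta N ^ j))"
proof -
  have N: "N > 0" using assms(1) prime_gt_0_nat by blast
  have "ipoly (norm_poly N P) (zeta N ^ m) = (\<Prod>j=1..N-1. ipoly P (zeta N ^ (m * j mod N)))"
    unfolding ipoly_norm_poly zeta_power_mod[OF N] by (simp add: power_mult)
  also have "\<dots> = (\<Prod>j=1..N-1. ipoly P (zeta N ^ j))"
    by (rule prod.reindex_bij_betw[OF bij_betw_mult_mod_prime[OF assms]])
  finally show ?thesis .
qed

text \<open>The sum of \<open>norm_poly\<close> over all roots: the root 1 gives the power, each of
  the others the norm. As an integrality statement it bounds subset sums from below; modulo
  \<open>N\<close>, with vanishing norm, it feeds the Eisenstein argument.\<close>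

lemma norm_poly_trace:
  assumes "prime N"
  obtains k :: int where
    "of_int (poly P 1) ^ (N - 1) + of_nat (N - 1) * (\<Prod>j=1..N-1. ipoly P (zeta N ^ j)) = of_nat N * of_int k"
proof -
  have N: "N > 0" using assms prime_gt_0_nat by blast
  obtain k :: int where k: "(\<Sum>j<N. ipoly (norm_poly N P) (zeta N ^ j)) = of_nat N * of_int k"
    using sum_ipoly_zeta_power[OF N] by blast
  have "(\<Sum>j<N. ipoly (norm_poly N P) (zeta N ^ j)) =
      ipoly (norm_poly N P) 1 + (\<Sum>m=1..N-1. ipoly (norm_poly N P) (zeta N ^ m))"
    using sum_lessThan_eq_add_atLeastAtMost[OF N, of "\<lambda>j. ipoly (norm_poly N P) (zeta N ^ j)"] by simp
  also have "(\<Sum>m=1..N-1. ipoly (norm_poly N P) (zeta N ^ m)) =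
      of_nat (N - 1) * (\<Prod>j=1..N-1. ipoly P (zeta N ^ j))"
    using ipoly_norm_poly_zeta_power[OF assms] by simp
  also have "ipoly (norm_poly N P) 1 = of_int (poly P 1) ^ (N - 1)"
    using ipoly_of_int[of P 1] by (simp add: ipoly_norm_poly)
  finally show ?thesis using k that[of k] by simp
qed

lemma prime_dvd_poly_1_if_zeta_root:
  assumes "prime N" "ipoly P (zeta N) = 0"
  shows "int N dvd poly P 1"
proof -
  have N: "N > 1" using assms(1) prime_gt_1_nat by blast
  obtain k :: int where
    k: "of_int (poly P 1) ^ (N - 1) + of_nat (N - 1) * (\<Prod>j=1..N-1. ipoly P (zeta N ^ j)) = of_nat N * (of_int k :: complex)"
    using norm_poly_trace[OF assms(1)] by blast
  have "(\<Prod>j=1..N-1. ipoly P (zeta N ^ j)) = 0"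
    by (rule prod_zero) (use assms(2) N in \<open>auto intro!: bexI[of _ 1]\<close>)
  hence "(of_int (poly P 1 ^ (N - 1)) :: complex) = of_int (int N * k)"
    using k by (simp only: mult_zero_right add_0_right of_int_power of_int_mult of_int_of_nat_eq)
  hence "poly P 1 ^ (N - 1) = int N * k" by (simp only: of_int_eq_iff)
  hence "int N dvd poly P 1 ^ (N - 1)" by simp
  moreover have "prime (int N)" using assms(1) by simp
  ultimately show ?thesis using prime_dvd_power by blast
qed

lemma prime_dvd_coeff_0_if_zeta_minus_1_root:
  assumes "prime N" "ipoly C (zeta N - 1) = 0"
  shows "int N dvd coeff C 0"
proof -
  have "ipoly (pcompose C [:-1, 1:]) (zeta N) = 0" using assms(2) by simp
  from prime_dvd_poly_1_if_zeta_root[OF assms(1) this] show ?thesis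
    by (simp add: poly_pcompose poly_0_coeff_0)
qed

section \<open>The Eisenstein argument and independence of the powers of
  \<open>zeta N\<close>\<close>

lemma prime_dvd_binomial:
  assumes "prime N" "0 < k" "k < N"
  shows "N dvd (N choose k)"
proof -
  have "k * (N choose k) = N * ((N - 1) choose (k - 1))"
    by (rule times_binomial_minus1_eq[OF assms(2)])
  hence "N dvd k * (N choose k)" by simp
  moreover have "\<not> N dvd k" using assms by (auto dest: dvd_imp_le)
  ultimately show ?thesis using assms(1) by (simp add: prime_dvd_mult_iff)
qed

text \<open>Expand \<open>(1 + \<pi>) ^ N = 1\<close> for \<open>\<pi> = zeta N - 1\<close> and
  cancel one factor \<open>\<pi>\<close>: the middle binomials are divisible by \<open>N\<close>,
  and \<open>(N choose 1) / N = 1\<close> is the constant coefficient of \<open>U\<close>.\<close>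

lemma zeta_minus_1_power:
  assumes "prime N"
  obtains U :: "int poly" where "coeff U 0 = 1"
    "(zeta N - 1) ^ (N - 1) = - (of_nat N * ipoly U (zeta N - 1))"
proof -
  define \<pi> where "\<pi> = zeta N - 1"
  define U :: "int poly" where "U = (\<Sum>k=1..N-1. monom (int ((N choose k) div N)) (k - 1))"
  have N: "N > 1" using assms prime_gt_1_nat by blast
  have "zeta N \<noteq> 1" using zeta_power_eq_1_iff[of N 1] N by auto
  hence \<pi>0: "\<pi> \<noteq> 0" by (simp add: \<pi>_def)
  have "zeta N ^ N = 1" using zeta_power_eq_1_iff[of N N] N by auto
  hence "1 = (\<pi> + 1) ^ N" by (simp add: \<pi>_def)
  also have "\<dots> = (\<Sum>k\<le>N. of_nat (N choose k) * \<pi> ^ k)" by (simp add: binomial_ring)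
  also have "{..N} = insert 0 (insert N {1..N-1})" using N by auto
  also have "(\<Sum>k\<in>\<dots>. of_nat (N choose k) * \<pi> ^ k) =
      1 + (\<pi> ^ N + (\<Sum>k=1..N-1. of_nat (N choose k) * \<pi> ^ k))"
    using N by (subst sum.insert; simp)+
  also have "(\<Sum>k=1..N-1. of_nat (N choose k) * \<pi> ^ k) = \<pi> * (of_nat N * ipoly U \<pi>)"
    unfolding U_def ipoly_sum sum_distrib_left
  proof (intro sum.cong refl)
    fix k assume k: "k \<in> {1..N-1}"
    have "N * ((N choose k) div N) = (N choose k)"
      using k by (intro dvd_mult_div_cancel prime_dvd_binomial[OF assms]) auto
    hence "of_nat (N choose k) = (of_nat N * of_nat ((N choose k) div N) :: complex)"
      by (metis of_nat_mult)
    moreover have "\<pi> ^ k = \<pi> * \<pi> ^ (k - 1)" using k by (cases k) auto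
    ultimately show "of_nat (N choose k) * \<pi> ^ k =
        \<pi> * (of_nat N * ipoly (monom (int ((N choose k) div N)) (k - 1)) \<pi>)" by simp
  qed
  also have "\<pi> ^ N = \<pi> * \<pi> ^ (N - 1)" using N by (cases N) auto
  finally have "\<pi> * (\<pi> ^ (N - 1) + of_nat N * ipoly U \<pi>) = 0" by (simp add: algebra_simps)
  hence "\<pi> ^ (N - 1) = - (of_nat N * ipoly U \<pi>)" using \<pi>0 by (simp add: add_eq_0_iff2)
  moreover have "coeff U 0 = 1"
  proof -
    have "coeff U 0 = (\<Sum>k=1..N-1. if k = 1 then 1 else 0)"
      unfolding U_def coeff_sum using N by (intro sum.cong) auto
    thus ?thesis using N by simp
  qed
  ultimately show ?thesis using that by (simp add: \<pi>_def)
qed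

text \<open>The Eisenstein argument for \<open>\<Phi>(1 + y) = y ^ (N - 1) + N * U(y)\<close>, carried out
  directly on the values at \<open>y = zeta N - 1\<close>.\<close>

lemma zeta_root_low_degree:
  assumes "prime N" "ipoly P (zeta N) = 0" "degree P < N - 1"
  shows "P = 0"
proof (rule ccontr)
  assume "P \<noteq> 0"
  define \<pi> where "\<pi> = zeta N - 1"
  have N: "N > 1" using assms(1) prime_gt_1_nat by blast
  define R0 where "R0 = pcompose P [:1, 1:]"
  \<comment> \<open>The primitive part has a coefficient not divisible by \<open>N\<close>, so the
    least such index \<open>m\<close> exists.\<close>
  define R where "R = primitive_part R0"
  have deg: "degree R = degree P" by (simp add: R_def R0_def degree_pcompose)
  have "R0 \<noteq> 0"
  proof
    assume "R0 = 0"
    hence "pcompose R0 [:-1, 1:] = 0" by simp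
    moreover have "pcompose R0 [:-1, 1:] = P"
      by (simp add: R0_def pcompose_pCons flip: pcompose_assoc)
    ultimately show False using \<open>P \<noteq> 0\<close> by simp
  qed
  hence content: "content R = 1" and c0: "content R0 \<noteq> 0" by (simp_all add: R_def)
  have "ipoly R0 \<pi> = 0" using assms(2) by (simp add: R0_def \<pi>_def)
  moreover have "ipoly R0 \<pi> = of_int (content R0) * ipoly R \<pi>"
    by (subst content_times_primitive_part[of R0, symmetric]) (simp only: ipoly_smult R_def)
  ultimately have R\<pi>: "ipoly R \<pi> = 0" using c0 by simp
  have ex: "\<exists>m. \<not> int N dvd coeff R m"
  proof (rule ccontr)
    assume "\<not> ?thesis"
    hence "[:int N:] dvd R" by (simp add: const_poly_dvd_iff)
    hence "int N dvd 1" using content by (simp add: const_poly_dvd_iff_dvd_content)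
    thus False using N by simp
  qed
  define m where "m = (LEAST m. \<not> int N dvd coeff R m)"
  have m: "\<not> int N dvd coeff R m" unfolding m_def using ex by (rule LeastI_ex)
  have low: "int N dvd coeff R k" if "k < m" for k
    using not_less_Least[OF that[unfolded m_def]] by simp
  have "coeff R m \<noteq> 0" using m by auto
  hence mN: "m < N - 1" using le_degree[of R m] deg assms(3) by simp
  have "[:int N:] dvd poly_cutoff m R"
    using low by (simp add: const_poly_dvd_iff coeff_poly_cutoff)
  then obtain A where "poly_cutoff m R = [:int N:] * A" by (rule dvdE)
  hence A: "poly_cutoff m R = smult (int N) A" by simp
  define B where "B = poly_shift m R"
  have RAB: "R = smult (int N) A + monom 1 m * B"
    unfolding A[symmetric] B_def
    by (rule poly_eqI) (auto simp: coeff_poly_cutoff coeff_monom_mult coeff_poly_shift)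
  obtain U :: "int poly" where U: "coeff U 0 = 1" "\<pi> ^ (N - 1) = - (of_nat N * ipoly U \<pi>)"
    unfolding \<pi>_def by (rule zeta_minus_1_power[OF assms(1)])
  \<comment> \<open>\<open>C\<close> is built so that
    \<open>N * C(\<pi>) = \<pi> ^ (N - 1 - m) * R(\<pi>)\<close>, which is 0. As
    \<open>m < N - 1\<close>, its first summand has no constant coefficient, so \<open>C(0)\<close>
    is minus the coefficient of \<open>R\<close> at \<open>m\<close>, yet must be divisible by
    \<open>N\<close>.\<close>
  define C where "C = monom 1 (N - 1 - m) * A - U * B"
  have "of_nat N * ipoly C \<pi> = \<pi> ^ (N - 1 - m) * (of_nat N * ipoly A \<pi>) + (- (of_nat N * ipoly U \<pi>)) * ipoly B \<pi>"
    by (simp add: C_def algebra_simps)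
  also have "- (of_nat N * ipoly U \<pi>) = \<pi> ^ (N - 1 - m) * \<pi> ^ m"
    unfolding U(2)[symmetric] power_add[symmetric] using mN by simp
  also have "\<pi> ^ (N - 1 - m) * (of_nat N * ipoly A \<pi>) + \<pi> ^ (N - 1 - m) * \<pi> ^ m * ipoly B \<pi> =
      \<pi> ^ (N - 1 - m) * ipoly R \<pi>"
    unfolding RAB by (simp add: algebra_simps)
  finally have "ipoly C \<pi> = 0" using R\<pi> N by simp
  hence "int N dvd coeff C 0"
    unfolding \<pi>_def by (rule prime_dvd_coeff_0_if_zeta_minus_1_root[OF assms(1)])
  moreover have "coeff C 0 = - coeff R m"
    using mN U(1) by (simp add: C_def B_def coeff_mult_0 coeff_monom_mult coeff_poly_shift)
  ultimately show False using m by simp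
qed

lemma zeta_powers_independent:
  assumes "prime N" "(\<Sum>i=1..N-1. of_int (c i) * zeta N ^ i) = 0" "i \<in> {1..N-1}"
  shows "c i = (0 :: int)"
proof -
  have N: "N > 1" using assms(1) prime_gt_1_nat by blast
  \<comment> \<open>One factor \<open>zeta N\<close> is divided out, so exponents stop at
    \<open>N - 2\<close> and \<open>zeta_root_low_degree\<close> applies.\<close>
  define P where "P = (\<Sum>i=1..N-1. monom (c i) (i - 1))"
  have "zeta N * ipoly P (zeta N) = (\<Sum>i=1..N-1. of_int (c i) * zeta N ^ i)"
    unfolding P_def ipoly_sum sum_distrib_left
  proof (intro sum.cong refl)
    fix i assume "i \<in> {1..N-1}"
    thus "zeta N * ipoly (monom (c i) (i - 1)) (zeta N) = of_int (c i) * zeta N ^ i"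
      by (cases i) auto
  qed
  hence "ipoly P (zeta N) = 0" using assms(2) by (simp add: zeta_def)
  moreover have "degree P < N - 1"
  proof (rule degree_lessI)
    show "\<forall>k\<ge>N - 1. coeff P k = 0"
      by (auto simp: P_def coeff_sum intro!: sum.neutral)
    show "P \<noteq> 0 \<or> 0 < N - 1" using N by simp
  qed
  ultimately have "P = 0" by (rule zeta_root_low_degree[OF assms(1)])
  moreover have "coeff P (i - 1) = (\<Sum>k=1..N-1. if k = i then c k else 0)"
    unfolding P_def coeff_sum using assms(3) by (intro sum.cong) (auto simp: eq_diff_iff)
  ultimately show ?thesis using assms(3) by simp
qed

section \<open>Reduction to the basis and transfer between conjugates\<close>

lemma sum_root_of_unity_powers:
  fixes z :: complex
  assumes "N > 0" "z ^ N = 1" "z \<noteq> 1"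
  shows "(\<Sum>i=1..N-1. z ^ i) = -1"
proof -
  have "(\<Sum>i<N. z ^ i) = 0" using assms by (simp add: geometric_sum)
  thus ?thesis
    using sum_lessThan_eq_add_atLeastAtMost[OF assms(1), of "\<lambda>i. z ^ i"] by (simp add: add_eq_0_iff)
qed

text \<open>The coefficients do not depend on \<open>z\<close>: one reduction serves all nontrivial
  roots at once, which later carries a relation at \<open>zeta N\<close> over to its
  conjugates.\<close>

lemma ipoly_reduce:
  assumes "N > 1"
  obtains c :: "nat \<Rightarrow> int" where
    "\<And>z. z ^ N = 1 \<Longrightarrow> z \<noteq> 1 \<Longrightarrow> ipoly P z = (\<Sum>i=1..N-1. of_int (c i) * z ^ i)"
proof -
  have "\<exists>c :: nat \<Rightarrow> int. \<forall>z. z ^ N = 1 \<longrightarrow> z \<noteq> 1 \<longrightarrow> ipoly P z = (\<Sum>i=1..N-1. of_int (c i) * z ^ i)"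
  proof (induction P)
    case 0
    show ?case by (rule exI[of _ "\<lambda>_. 0"]) simp
  next
    case (pCons a P)
    then obtain c :: "nat \<Rightarrow> int" where
      c: "\<And>z. z ^ N = 1 \<Longrightarrow> z \<noteq> 1 \<Longrightarrow> ipoly P z = (\<Sum>i=1..N-1. of_int (c i) * z ^ i)"
      by blast
    \<comment> \<open>Multiplication by \<open>z\<close> shifts the indices. The overflow
      \<open>c (N - 1) * z ^ N\<close> and the constant \<open>a\<close> are both integers,
      rewritten with 1 as minus the sum of the powers of \<open>z\<close>.\<close>
    define d where "d = (\<lambda>i. (if i = 1 then 0 else c (i - 1)) - (a + c (N - 1)))"
    show ?case
    proof (intro exI[of _ d] allI impI)
      fix z :: complex assume z: "z ^ N = 1" "z \<noteq> 1"
      obtain M where M: "N = Suc (Suc M)" using assms by (auto dest: less_imp_Suc_add)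
      have "ipoly (pCons a P) z = of_int a + (\<Sum>i=1..N-1. of_int (c i) * z ^ Suc i)"
        using c[OF z] by (simp add: sum_distrib_left mult_ac)
      also have "(\<Sum>i=1..N-1. of_int (c i) * z ^ Suc i) = (\<Sum>i=1..M. of_int (c i) * z ^ Suc i) + of_int (c (N - 1))"
        using z(1) by (simp add: M)
      also have "(\<Sum>i=1..M. of_int (c i) * z ^ Suc i) = (\<Sum>i=2..N-1. of_int (c (i - 1)) * z ^ i)"
        unfolding M by (rule sum.reindex_bij_witness[of _ "\<lambda>i. i - 1" Suc]) auto
      also have "\<dots> = (\<Sum>i=1..N-1. of_int (if i = 1 then 0 else c (i - 1)) * z ^ i)"
        by (rule sum.mono_neutral_cong_left) auto
      finally have "ipoly (pCons a P) z = (\<Sum>i=1..N-1. of_int (if i = 1 then 0 else c (i - 1)) * z ^ i)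
          - of_int (a + c (N - 1)) * (\<Sum>i=1..N-1. z ^ i)"
        using sum_root_of_unity_powers[OF _ z] assms by simp
      also have "\<dots> = (\<Sum>i=1..N-1. of_int (d i) * z ^ i)"
        unfolding sum_distrib_left sum_subtractf[symmetric] d_def by (intro sum.cong refl) (simp add: algebra_simps)
      finally show "ipoly (pCons a P) z = (\<Sum>i=1..N-1. of_int (d i) * z ^ i)" .
    qed
  qed
  thus ?thesis using that by blast
qed

text \<open>Independence forces the reduced coefficients to vanish, and all conjugates share them.
  This is what makes the automorphisms well defined.\<close>

lemma ipoly_zeta_power_eq_0:
  assumes "prime N" "ipoly P (zeta N) = 0" "j \<in> {1..N-1}"
  shows "ipoly P (zeta N ^ j) = 0"
proof -
  have N: "N > 1" using assms(1) prime_gt_1_nat by blast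
  have root: "(zeta N ^ i) ^ N = 1" "zeta N ^ i \<noteq> 1" if "i \<in> {1..N-1}" for i
    using zeta_power_eq_1_iff[of N "i * N"] zeta_power_eq_1_iff[of N i] that N
    by (auto simp: power_mult dest: dvd_imp_le)
  obtain c :: "nat \<Rightarrow> int" where
    c: "\<And>z. z ^ N = 1 \<Longrightarrow> z \<noteq> 1 \<Longrightarrow> ipoly P z = (\<Sum>i=1..N-1. of_int (c i) * z ^ i)"
    using ipoly_reduce[OF N] by blast
  have "c i = 0" if "i \<in> {1..N-1}" for i
    using zeta_powers_independent[OF assms(1) _ that, of c] c[of "zeta N"] root[of 1] assms(2) N by simp
  thus ?thesis using c[OF root[OF assms(3)]] by simp
qed

section \<open>Binary elements\<close>

lemma cyclotomic_ring_closed: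
  shows ipoly_in_cyclotomic_ring: "ipoly P (zeta N) \<in> cyclotomic_ring N"
    and "x \<in> cyclotomic_ring N \<Longrightarrow> y \<in> cyclotomic_ring N \<Longrightarrow> x + y \<in> cyclotomic_ring N"
    and "x \<in> cyclotomic_ring N \<Longrightarrow> y \<in> cyclotomic_ring N \<Longrightarrow> x * y \<in> cyclotomic_ring N"
    and "zeta N \<in> cyclotomic_ring N" and "of_int a \<in> cyclotomic_ring N"
proof -
  show 1: "ipoly P (zeta N) \<in> cyclotomic_ring N" for P by (simp add: cyclotomic_ring_eq)
  show "x \<in> cyclotomic_ring N \<Longrightarrow> y \<in> cyclotomic_ring N \<Longrightarrow> x + y \<in> cyclotomic_ring N"
    by (auto simp: cyclotomic_ring_eq simp flip: ipoly_add)
  show "x \<in> cyclotomic_ring N \<Longrightarrow> y \<in> cyclotomic_ring N \<Longrightarrow> x * y \<in> cyclotomic_ring N"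
    by (auto simp: cyclotomic_ring_eq simp flip: ipoly_mult)
  show "zeta N \<in> cyclotomic_ring N" using 1[of "[:0, 1:]"] by simp
  show "of_int a \<in> cyclotomic_ring N" using 1[of "[:a:]"] by simp
qed

section \<open>Automorphisms and the norm\<close>

lemma zeta_power_inverse:
  assumes "prime N" "j \<in> {1..N-1}"
  obtains j' where "j' \<in> {1..N-1}" "(zeta N ^ j) ^ j' = zeta N"
proof -
  obtain j' where j': "j' \<in> {1..N-1}" "j * j' mod N = 1"
    using prime_inverse_mod[OF assms] by blast
  have "(zeta N ^ j) ^ j' = zeta N ^ (j * j' mod N)"
    using zeta_power_mod[of N "j * j'"] assms(1) prime_gt_0_nat by (simp add: power_mult)
  thus ?thesis using that[of j'] j' by simp
qed

lemma ring_automorphism_exists: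
  assumes "prime N" "j \<in> {1..N-1}"
  shows "\<exists>\<sigma>. ring_automorphism (cyclotomic_ring N) \<sigma> \<and> \<sigma> (zeta N) = zeta N ^ j"
proof -
  define \<sigma> where "\<sigma> = (\<lambda>x. ipoly (SOME P. x = ipoly P (zeta N)) (zeta N ^ j))"
  have \<sigma>: "\<sigma> (ipoly P (zeta N)) = ipoly P (zeta N ^ j)" for P
  proof -
    define Q where "Q = (SOME Q. ipoly P (zeta N) = ipoly Q (zeta N))"
    have "ipoly P (zeta N) = ipoly Q (zeta N)" unfolding Q_def by (rule someI[of _ P]) simp
    hence "ipoly (Q - P) (zeta N) = 0" by simp
    hence "ipoly (Q - P) (zeta N ^ j) = 0" by (rule ipoly_zeta_power_eq_0[OF assms(1) _ assms(2)])
    thus ?thesis by (simp add: \<sigma>_def Q_def)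
  qed
  obtain j' where j': "j' \<in> {1..N-1}" "(zeta N ^ j) ^ j' = zeta N"
    using zeta_power_inverse[OF assms] by blast
  have inj: "inj_on \<sigma> (cyclotomic_ring N)"
  proof (rule inj_onI)
    fix x y assume "x \<in> cyclotomic_ring N" "y \<in> cyclotomic_ring N" "\<sigma> x = \<sigma> y"
    then obtain P Q where PQ: "x = ipoly P (zeta N)" "y = ipoly Q (zeta N)"
      "ipoly P (zeta N ^ j) = ipoly Q (zeta N ^ j)"
      by (auto simp: cyclotomic_ring_eq \<sigma>)
    \<comment> \<open>A relation at \<open>zeta N ^ j\<close> is one at \<open>zeta N\<close> for
      the composed polynomial; moved to the inverse exponent \<open>j'\<close>, it becomes a
      relation for \<open>P - Q\<close> at \<open>zeta N\<close>.\<close>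
    hence "ipoly (pcompose (P - Q) (monom 1 j)) (zeta N) = 0" by simp
    hence "ipoly (pcompose (P - Q) (monom 1 j)) (zeta N ^ j') = 0"
      by (rule ipoly_zeta_power_eq_0[OF assms(1) _ j'(1)])
    moreover have "(zeta N ^ j') ^ j = zeta N" using j'(2) by (simp add: power_mult[symmetric] mult.commute)
    ultimately show "x = y" using PQ by simp
  qed
  have surj: "\<sigma> ` cyclotomic_ring N = cyclotomic_ring N"
  proof safe
    fix x assume "x \<in> cyclotomic_ring N"
    then obtain P where P: "x = ipoly P (zeta N)" by (auto simp: cyclotomic_ring_eq)
    have "\<sigma> x = ipoly (pcompose P (monom 1 j)) (zeta N)" by (simp add: P \<sigma>)
    thus "\<sigma> x \<in> cyclotomic_ring N" by (simp only: ipoly_in_cyclotomic_ring)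
    have "\<sigma> (ipoly (pcompose P (monom 1 j')) (zeta N)) = x"
      unfolding \<sigma> using j'(2) by (simp add: P)
    thus "x \<in> \<sigma> ` cyclotomic_ring N" using ipoly_in_cyclotomic_ring by blast
  qed
  have "\<sigma> 1 = 1" using \<sigma>[of 1] by simp
  moreover have "\<sigma> (x + y) = \<sigma> x + \<sigma> y" "\<sigma> (x * y) = \<sigma> x * \<sigma> y"
    if xy: "x \<in> cyclotomic_ring N" "y \<in> cyclotomic_ring N" for x y
  proof -
    obtain P Q where PQ: "x = ipoly P (zeta N)" "y = ipoly Q (zeta N)"
      using xy by (auto simp: cyclotomic_ring_eq)
    show "\<sigma> (x + y) = \<sigma> x + \<sigma> y" "\<sigma> (x * y) = \<sigma> x * \<sigma> y"
      unfolding PQ ipoly_add[symmetric] ipoly_mult[symmetric] \<sigma> by simp_all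
  qed
  ultimately have "ring_automorphism (cyclotomic_ring N) \<sigma>"
    using inj surj by (simp add: ring_automorphism_def bij_betw_def)
  moreover have "\<sigma> (zeta N) = zeta N ^ j" using \<sigma>[of "[:0, 1:]"] by simp
  ultimately show ?thesis by blast
qed

text \<open>Whichever automorphism the choice operator picks, additivity determines it on the
  integers and its value at \<open>zeta N\<close> on the rest of the ring.\<close>

lemma conj_aut_ipoly:
  assumes "prime N" "j \<in> {1..N-1}"
  shows "conj_aut N j (ipoly P (zeta N)) = ipoly P (zeta N ^ j)"
proof -
  define \<sigma> where "\<sigma> = conj_aut N j"
  have \<sigma>: "ring_automorphism (cyclotomic_ring N) \<sigma>" "\<sigma> (zeta N) = zeta N ^ j"
    using someI_ex[OF ring_automorphism_exists[OF assms]] by (simp_all add: \<sigma>_def conj_aut_def)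
  have add: "\<sigma> (x + y) = \<sigma> x + \<sigma> y" and mult: "\<sigma> (x * y) = \<sigma> x * \<sigma> y"
    if "x \<in> cyclotomic_ring N" "y \<in> cyclotomic_ring N" for x y
    using \<sigma>(1) that by (auto simp: ring_automorphism_def)
  have int: "of_int k \<in> cyclotomic_ring N" for k by (rule cyclotomic_ring_closed)
  have zero: "\<sigma> 0 = 0" using add[OF int[of 0] int[of 0]] by simp
  have one: "\<sigma> 1 = 1" using \<sigma>(1) by (simp add: ring_automorphism_def)
  have \<sigma>_int: "\<sigma> (of_int a) = of_int a" for a
  proof (induction a rule: int_induct[of _ 0])
    case base
    show ?case by (simp add: zero)
  next
    case (step1 i)
    thus ?case using add[OF int[of i] int[of 1]] by (simp add: one)
  next
    case (step2 i)
    thus ?case using add[OF int[of "i - 1"] int[of 1]] by (simp add: one eq_diff_eq)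
  qed
  have "\<sigma> (ipoly P (zeta N)) = ipoly P (zeta N ^ j)"
  proof (induction P)
    case 0
    show ?case by (simp add: zero)
  next
    case (pCons a P)
    have "\<sigma> (of_int a + zeta N * ipoly P (zeta N)) = \<sigma> (of_int a) + \<sigma> (zeta N) * \<sigma> (ipoly P (zeta N))"
      using add mult cyclotomic_ring_closed by metis
    thus ?case using pCons by (simp add: \<sigma>_int \<sigma>(2))
  qed
  thus ?thesis by (simp add: \<sigma>_def)
qed

lemma ipoly_cnj: "ipoly P (cnj z) = cnj (ipoly P z)"
  by (induction P) simp_all

text \<open>For odd \<open>N\<close> the factors at \<open>j\<close> and \<open>N - j\<close> pair
  off as complex conjugates, so the norm is a product of squared moduli and taking the real part
  loses nothing.\<close>

lemma log_norm_ipoly: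
  assumes "prime N" "odd N"
  shows "log_norm N (ipoly P (zeta N)) = ln (\<Prod>j=1..N-1. norm (ipoly P (zeta N ^ j)))"
proof -
  define x where "x = (\<lambda>j. ipoly P (zeta N ^ j))"
  define h where "h = (N - 1) div 2"
  have N: "N > 0" using assms(1) prime_gt_0_nat by blast
  have h: "N - 1 = 2 * h" using assms(2) N by (auto simp: h_def elim: oddE)
  have cnj: "x (N - j) = cnj (x j)" if "j \<in> {1..h}" for j
  proof -
    have "j \<le> N" using that h by auto
    hence "zeta N ^ (N - j) * zeta N ^ j = 1"
      using zeta_power_eq_1_iff[OF N, of N] by (simp add: power_add[symmetric])
    hence "zeta N ^ (N - j) = inverse (zeta N ^ j)"
      by (metis inverse_unique mult.commute)
    also have "\<dots> = cnj (zeta N ^ j)"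
      unfolding zeta_power by (simp add: cis_cnj)
    finally show ?thesis by (simp add: x_def ipoly_cnj del: complex_cnj_power)
  qed
  have "{1..N-1} = {1..h} \<union> {h+1..2*h}" unfolding h by auto
  hence "(\<Prod>j=1..N-1. x j) = (\<Prod>j=1..h. x j) * (\<Prod>j=h+1..2*h. x j)"
    by (simp add: prod.union_disjoint)
  also have "(\<Prod>j=h+1..2*h. x j) = (\<Prod>j=1..h. x (N - j))"
    by (rule prod.reindex_bij_witness[of _ "\<lambda>j. N - j" "\<lambda>j. N - j"]) (use h N in auto)
  also have "(\<Prod>j=1..h. x j) * \<dots> = (\<Prod>j=1..h. x j * cnj (x j))"
    unfolding prod.distrib by (simp add: cnj)
  also have "\<dots> = of_real (\<Prod>j=1..h. (norm (x j))\<^sup>2)"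
    by (simp add: complex_norm_square[symmetric])
  finally have eq: "(\<Prod>j=1..N-1. x j) = of_real (\<Prod>j=1..h. (norm (x j))\<^sup>2)" .
  have "Re (\<Prod>j=1..N-1. x j) = norm (\<Prod>j=1..N-1. x j)"
    unfolding eq by (simp add: prod_nonneg del: of_real_prod)
  also have "\<dots> = (\<Prod>j=1..N-1. norm (x j))" by (simp add: prod_norm)
  finally have "Re (\<Prod>j=1..N-1. x j) = (\<Prod>j=1..N-1. norm (x j))" .
  moreover have "cyclotomic_norm N (ipoly P (zeta N)) = (\<Prod>j=1..N-1. x j)"
    unfolding cyclotomic_norm_def x_def using assms(1) by (intro prod.cong refl conj_aut_ipoly)
  ultimately show ?thesis by (simp add: log_norm_def x_def)
qed

section \<open>Subset sums of roots of unity and their size\<close>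

definition zeta_sum :: "nat \<Rightarrow> nat set \<Rightarrow> complex" where
  "zeta_sum N A = (\<Sum>i\<in>A. zeta N ^ i)"

lemma zeta_sum_eq_indicator:
  assumes "A \<subseteq> {1..N-1}"
  shows "zeta_sum N A = (\<Sum>i=1..N-1. of_int (of_bool (i \<in> A)) * zeta N ^ i)"
  unfolding zeta_sum_def by (rule sum.mono_neutral_cong_left) (use assms in auto)

lemma zeta_sum_eq_0_iff:
  assumes "prime N" "A \<subseteq> {1..N-1}"
  shows "zeta_sum N A = 0 \<longleftrightarrow> A = {}"
proof
  assume "zeta_sum N A = 0"
  hence "(\<Sum>i=1..N-1. of_int (of_bool (i \<in> A)) * zeta N ^ i) = 0"
    using zeta_sum_eq_indicator[OF assms(2)] by simp
  hence "of_bool (i \<in> A) = (0 :: int)" if "i \<in> {1..N-1}" for i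
    using that by (rule zeta_powers_independent[OF assms(1)])
  thus "A = {}" using assms(2) by fastforce
qed (simp add: zeta_sum_def)

text \<open>Conjugates of subset sums are again subset sums; both the size bound on conjugates and
  the averaging over them rest on this.\<close>

lemma ipoly_zeta_power_eq_zeta_sum:
  assumes "prime N" "j \<in> {1..N-1}" "A \<subseteq> {1..N-1}"
  shows "ipoly (\<Sum>i\<in>A. monom 1 i) (zeta N ^ j) = zeta_sum N ((\<lambda>i. j * i mod N) ` A)"
proof -
  have N: "N > 0" using assms(1) prime_gt_0_nat by blast
  have "inj_on (\<lambda>i. j * i mod N) A"
    using bij_betw_imp_inj_on[OF bij_betw_mult_mod_prime[OF assms(1,2)]] assms(3) by (rule inj_on_subset)
  thus ?thesis
    by (simp add: zeta_sum_def sum.reindex zeta_power_mod[OF N] power_mult)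
qed

lemma norm_zeta_sum_le: "norm (zeta_sum N A) \<le> real (card A)"
  unfolding zeta_sum_def by (rule order_trans[OF norm_sum]) simp

lemma bij_betw_image_nonempty_Pow:
  assumes "bij_betw f A A"
  shows "bij_betw ((`) f) (Pow A - {{}}) (Pow A - {{}})"
proof -
  have inj: "inj_on ((`) f) (Pow A)" and im: "(`) f ` Pow A = Pow A"
    using bij_betw_Pow[OF assms] by (auto simp: bij_betw_def)
  have "(`) f ` (Pow A - {{}}) = (`) f ` Pow A - (`) f ` {{}}"
    using inj by (intro inj_on_image_set_diff) auto
  thus ?thesis
    using inj_on_subset[OF inj Diff_subset] by (simp add: bij_betw_def im)
qed

text \<open>The integer \<open>(N - 1) * V\<close> is nonzero, and every conjugate is at most
  \<open>N\<close>, so the factor at \<open>j = 1\<close> cannot be too small.\<close>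

lemma norm_zeta_sum_lower_bound:
  assumes "prime N" "A \<subseteq> {1..N-1}" "A \<noteq> {}"
  shows "1 \<le> norm (zeta_sum N A) * real N ^ N"
proof -
  have N: "N > 1" using assms(1) prime_gt_1_nat by blast
  define P :: "int poly" where "P = (\<Sum>i\<in>A. monom 1 i)"
  define V where "V = (\<Prod>j=1..N-1. ipoly P (zeta N ^ j))"
  have x: "ipoly P (zeta N ^ j) \<noteq> 0" "norm (ipoly P (zeta N ^ j)) \<le> real N" if j: "j \<in> {1..N-1}" for j
  proof -
    let ?B = "(\<lambda>i. j * i mod N) ` A"
    have B: "?B \<subseteq> {1..N-1}" "?B \<noteq> {}"
      using bij_betw_imp_surj_on[OF bij_betw_mult_mod_prime[OF assms(1) j]] assms(2,3) by blast+
    have eq: "ipoly P (zeta N ^ j) = zeta_sum N ?B"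
      unfolding P_def by (rule ipoly_zeta_power_eq_zeta_sum[OF assms(1) j assms(2)])
    show "ipoly P (zeta N ^ j) \<noteq> 0" using zeta_sum_eq_0_iff[OF assms(1) B(1)] B(2) eq by simp
    have "card ?B \<le> card {1..N-1}" using B(1) by (intro card_mono) auto
    hence "real (card ?B) \<le> real N" by simp
    thus "norm (ipoly P (zeta N ^ j)) \<le> real N" using norm_zeta_sum_le[of N ?B] eq by simp
  qed
  obtain k :: int where k: "of_int (poly P 1) ^ (N - 1) + of_nat (N - 1) * V = of_nat N * of_int k"
    unfolding V_def by (rule norm_poly_trace[OF assms(1)])
  have "of_nat (N - 1) * V = of_nat N * of_int k - of_int (poly P 1) ^ (N - 1)"
    unfolding k[symmetric] by (rule add_diff_cancel_left'[symmetric])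
  hence V: "of_nat (N - 1) * V = of_int (int N * k - poly P 1 ^ (N - 1))" by simp
  have "V \<noteq> 0" unfolding V_def using x(1) by simp
  hence "of_nat (N - 1) * V \<noteq> 0" using N by simp
  hence "int N * k - poly P 1 ^ (N - 1) \<noteq> 0" unfolding V by (metis of_int_0)
  hence "1 \<le> \<bar>int N * k - poly P 1 ^ (N - 1)\<bar>" by linarith
  hence "(1 :: real) \<le> of_int \<bar>int N * k - poly P 1 ^ (N - 1)\<bar>" by linarith
  also have "\<dots> = norm (of_nat (N - 1) * V)" unfolding V norm_of_int by simp
  also have "\<dots> = real (N - 1) * norm V" by (simp add: norm_mult)
  also have "norm V = norm (zeta_sum N A) * (\<Prod>j=2..N-1. norm (ipoly P (zeta N ^ j)))"
  proof -
    have "{1..N-1} = insert 1 {2..N-1}" using N by auto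
    thus ?thesis unfolding V_def prod_norm[symmetric] by (simp add: P_def zeta_sum_def)
  qed
  also have "(\<Prod>j=2..N-1. norm (ipoly P (zeta N ^ j))) \<le> (\<Prod>j=2..N-1. real N)"
    by (intro prod_mono) (use x(2) in auto)
  also have "(\<Prod>j=2..N-1. real N) = real N ^ (N - 2)" by (simp add: numeral_2_eq_2)
  \<comment> \<open>The factor \<open>(N - 1) * N ^ (N - 2)\<close> is rounded up to
    \<open>N ^ N\<close>; only the order of its logarithm matters.\<close>
  also have "real (N - 1) * (norm (zeta_sum N A) * real N ^ (N - 2)) \<le>
      real N * (norm (zeta_sum N A) * real N ^ (N - 1))"
    using N by (intro mult_mono mult_left_mono power_increasing) auto
  also have "\<dots> = norm (zeta_sum N A) * real N ^ N" using N by (cases N) auto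
  finally show ?thesis by (simp add: mult_left_mono)
qed

section \<open>Enumeration of the binary elements\<close>

lemma coords_eq:
  assumes "prime N" "\<And>i. i \<notin> {1..N-1} \<Longrightarrow> c i = 0"
  shows "coords N (\<Sum>i=1..N-1. of_int (c i) * zeta N ^ i) = c"
  unfolding coords_def
proof (rule the_equality)
  fix d assume d: "(\<forall>i. i \<notin> {1..N - 1} \<longrightarrow> d i = 0) \<and>
    (\<Sum>i=1..N-1. of_int (c i) * zeta N ^ i) = (\<Sum>i = 1..N - 1. of_int (d i) * zeta N ^ i)"
  hence "(\<Sum>i=1..N-1. of_int (d i - c i) * zeta N ^ i) = 0"
    by (simp add: left_diff_distrib sum_subtractf)
  hence "d i - c i = 0" if "i \<in> {1..N-1}" for i
    using that by (rule zeta_powers_independent[OF assms(1)])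
  thus "d = c" using d assms(2) by (intro ext) (metis eq_iff_diff_eq_0)
qed (use assms(2) in auto)

lemma binary_elements_eq:
  assumes "prime N"
  shows "binary_elements N =
    zeta_sum N ` (Pow {1..N-1} - {{}}) \<union> (\<lambda>A. - zeta_sum N A) ` (Pow {1..N-1} - {{}})"
proof (intro equalityI subsetI)
  have N: "N > 1" using assms prime_gt_1_nat by blast
  fix \<beta> assume \<beta>: "\<beta> \<in> binary_elements N"
  then obtain P where P: "\<beta> = ipoly P (zeta N)"
    by (auto simp: binary_elements_def cyclotomic_ring_eq)
  obtain c0 :: "nat \<Rightarrow> int" where
    c0: "\<And>z. z ^ N = 1 \<Longrightarrow> z \<noteq> 1 \<Longrightarrow> ipoly P z = (\<Sum>i=1..N-1. of_int (c0 i) * z ^ i)"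
    using ipoly_reduce[OF N] by blast
  define c where "c = (\<lambda>i. if i \<in> {1..N-1} then c0 i else 0)"
  have "zeta N ^ N = 1" "zeta N \<noteq> 1"
    using zeta_power_eq_1_iff[of N N] zeta_power_eq_1_iff[of N 1] N by auto
  from c0[OF this] have c: "\<beta> = (\<Sum>i=1..N-1. of_int (c i) * zeta N ^ i)"
    unfolding P by (simp add: c_def)
  have coords: "coords N \<beta> = c" unfolding c by (rule coords_eq[OF assms]) (auto simp: c_def)
  have "\<beta> \<noteq> 0" using \<beta> by (simp add: binary_elements_def)
  from \<beta> coords consider "\<forall>i\<in>{1..N-1}. c i \<in> {0, 1}" | "\<forall>i\<in>{1..N-1}. c i \<in> {-1, 0}"
    by (auto simp: binary_elements_def)
  thus "\<beta> \<in> zeta_sum N ` (Pow {1..N-1} - {{}}) \<union> (\<lambda>A. - zeta_sum N A) ` (Pow {1..N-1} - {{}})"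
  proof cases
    case 1
    define A where "A = {i\<in>{1..N-1}. c i = 1}"
    have "\<beta> = zeta_sum N A" unfolding c zeta_sum_def
      by (rule sum.mono_neutral_cong_right) (use 1 in \<open>auto simp: A_def\<close>)
    moreover from this have "A \<noteq> {}" using \<open>\<beta> \<noteq> 0\<close> by (auto simp: zeta_sum_def)
    ultimately show ?thesis by (auto simp: A_def)
  next
    case 2
    define A where "A = {i\<in>{1..N-1}. c i = -1}"
    have "\<beta> = - zeta_sum N A" unfolding c zeta_sum_def sum_negf[symmetric]
      by (rule sum.mono_neutral_cong_right) (use 2 in \<open>auto simp: A_def\<close>)
    moreover from this have "A \<noteq> {}" using \<open>\<beta> \<noteq> 0\<close> by (auto simp: zeta_sum_def)
    ultimately show ?thesis by (auto simp: A_def)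
  qed
next
  fix \<beta> assume "\<beta> \<in> zeta_sum N ` (Pow {1..N-1} - {{}}) \<union> (\<lambda>A. - zeta_sum N A) ` (Pow {1..N-1} - {{}})"
  then obtain A where A: "A \<subseteq> {1..N-1}" "A \<noteq> {}" "\<beta> = zeta_sum N A \<or> \<beta> = - zeta_sum N A" by auto
  define s :: int where "s = (if \<beta> = zeta_sum N A then 1 else -1)"
  have \<beta>: "\<beta> = of_int s * zeta_sum N A" using A(3) by (auto simp: s_def)
  have "\<beta> = ipoly (smult s (\<Sum>i\<in>A. monom 1 i)) (zeta N)"
    by (simp add: \<beta> zeta_sum_def)
  hence "\<beta> \<in> cyclotomic_ring N" by (simp only: ipoly_in_cyclotomic_ring)
  moreover have "\<beta> \<noteq> 0" using A zeta_sum_eq_0_iff[OF assms A(1)] by auto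
  moreover have "coords N \<beta> = (\<lambda>i. s * of_bool (i \<in> A))"
  proof -
    have "\<beta> = (\<Sum>i=1..N-1. of_int (s * of_bool (i \<in> A)) * zeta N ^ i)"
      unfolding \<beta> zeta_sum_eq_indicator[OF A(1)] sum_distrib_left by (intro sum.cong) (auto simp: mult_ac)
    thus ?thesis using coords_eq[OF assms, of "\<lambda>i. s * of_bool (i \<in> A)"] A(1) by fastforce
  qed
  moreover have "s = 1 \<or> s = -1" by (auto simp: s_def)
  ultimately show "\<beta> \<in> binary_elements N"
    by (auto simp: binary_elements_def)
qed

lemma inj_on_zeta_sum:
  assumes "prime N"
  shows "inj_on (zeta_sum N) (Pow {1..N-1})"
proof (rule inj_onI)
  fix A B assume AB: "A \<in> Pow {1..N-1}" "B \<in> Pow {1..N-1}" "zeta_sum N A = zeta_sum N B"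
  hence "(\<Sum>i=1..N-1. of_int (of_bool (i \<in> A) - of_bool (i \<in> B)) * zeta N ^ i) = 0"
    using zeta_sum_eq_indicator[of A N] zeta_sum_eq_indicator[of B N]
    by (simp add: left_diff_distrib sum_subtractf)
  hence "of_bool (i \<in> A) - of_bool (i \<in> B) = (0 :: int)" if "i \<in> {1..N-1}" for i
    using that by (rule zeta_powers_independent[OF assms])
  hence "i \<in> A \<longleftrightarrow> i \<in> B" if "i \<in> {1..N-1}" for i
    using that by (fastforce split: if_splits)
  thus "A = B" using AB(1,2) by blast
qed

text \<open>Indicator vectors have no cancellation when added. Hence the two sign families of binary
  elements are disjoint and the count doubles.\<close>

lemma zeta_sum_neq_uminus:
  assumes "prime N" "A \<in> Pow {1..N-1} - {{}}" "B \<in> Pow {1..N-1} - {{}}"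
  shows "zeta_sum N A \<noteq> - zeta_sum N B"
proof
  assume "zeta_sum N A = - zeta_sum N B"
  hence "zeta_sum N A + zeta_sum N B = 0" by simp
  moreover have "A \<subseteq> {1..N-1}" "B \<subseteq> {1..N-1}" using assms(2,3) by auto
  ultimately have "(\<Sum>i=1..N-1. of_int (of_bool (i \<in> A) + of_bool (i \<in> B)) * zeta N ^ i) = 0"
    by (simp only: zeta_sum_eq_indicator of_int_add distrib_right sum.distrib)
  hence "of_bool (i \<in> A) + of_bool (i \<in> B) = (0 :: int)" if "i \<in> {1..N-1}" for i
    using that by (rule zeta_powers_independent[OF assms(1)])
  hence "i \<notin> A" if "i \<in> {1..N-1}" for i
    using that by (cases "i \<in> A"; cases "i \<in> B"; force)
  thus False using assms(2) by blast
qed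

section \<open>The expectation and its asymptotics\<close>

lemma log_norm_zeta_sum:
  assumes "prime N" "odd N" "A \<in> Pow {1..N-1} - {{}}"
  shows "log_norm N (zeta_sum N A) = (\<Sum>j=1..N-1. ln (norm (zeta_sum N ((\<lambda>i. j * i mod N) ` A))))"
    and "log_norm N (- zeta_sum N A) = log_norm N (zeta_sum N A)"
proof -
  define P :: "int poly" where "P = (\<Sum>i\<in>A. monom 1 i)"
  have P: "zeta_sum N A = ipoly P (zeta N)" by (simp add: P_def zeta_sum_def)
  have x: "ipoly P (zeta N ^ j) = zeta_sum N ((\<lambda>i. j * i mod N) ` A)" if "j \<in> {1..N-1}" for j
    unfolding P_def using assms(3) by (intro ipoly_zeta_power_eq_zeta_sum[OF assms(1) that]) auto
  have nz: "zeta_sum N ((\<lambda>i. j * i mod N) ` A) \<noteq> 0" if j: "j \<in> {1..N-1}" for j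
  proof -
    have "(\<lambda>i. j * i mod N) ` A \<subseteq> {1..N-1}"
      using bij_betw_imp_surj_on[OF bij_betw_mult_mod_prime[OF assms(1) j]] assms(3) by blast
    thus ?thesis using zeta_sum_eq_0_iff[OF assms(1)] assms(3) by blast
  qed
  have "log_norm N (zeta_sum N A) = ln (\<Prod>j=1..N-1. norm (zeta_sum N ((\<lambda>i. j * i mod N) ` A)))"
    unfolding P log_norm_ipoly[OF assms(1,2)] using x by simp
  also have "\<dots> = (\<Sum>j=1..N-1. ln (norm (zeta_sum N ((\<lambda>i. j * i mod N) ` A))))"
    using nz by (intro ln_prod) auto
  finally show "log_norm N (zeta_sum N A) = (\<Sum>j=1..N-1. ln (norm (zeta_sum N ((\<lambda>i. j * i mod N) ` A))))" .
  have "log_norm N (- zeta_sum N A) = log_norm N (ipoly (- P) (zeta N))" by (simp add: P)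
  also have "\<dots> = log_norm N (zeta_sum N A)"
    unfolding P log_norm_ipoly[OF assms(1,2)] by simp
  finally show "log_norm N (- zeta_sum N A) = log_norm N (zeta_sum N A)" .
qed

lemma expected_log_norm_eq:
  assumes "prime N" "odd N"
  shows "expected_log_norm N =
    real (N - 1) * (\<Sum>A\<in>Pow {1..N-1} - {{}}. ln (norm (zeta_sum N A))) / (2 ^ (N - 1) - 1)"
proof -
  let ?S = "Pow {1..N-1} - {{}}"
  define S1 where "S1 = zeta_sum N ` ?S"
  define S2 where "S2 = (\<lambda>A. - zeta_sum N A) ` ?S"
  define T where "T = (\<Sum>A\<in>?S. ln (norm (zeta_sum N A)))"
  have N: "N > 1" using assms(1) prime_gt_1_nat by blast
  have inj1: "inj_on (zeta_sum N) ?S"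
    using inj_on_zeta_sum[OF assms(1)] by (rule inj_on_subset) auto
  hence inj2: "inj_on (\<lambda>A. - zeta_sum N A) ?S" by (auto simp: inj_on_def)
  have disj: "S1 \<inter> S2 = {}"
    unfolding S1_def S2_def using zeta_sum_neq_uminus[OF assms(1)] by blast
  have fin: "finite S1" "finite S2" by (auto simp: S1_def S2_def)
  have bin: "binary_elements N = S1 \<union> S2"
    unfolding S1_def S2_def by (rule binary_elements_eq[OF assms(1)])
  have cardS: "real (card ?S) = 2 ^ (N - 1) - 1"
    by (subst card_Diff_singleton) (auto simp: card_Pow of_nat_diff)
  have card: "real (card (binary_elements N)) = 2 * (2 ^ (N - 1) - 1)"
  proof -
    have "card S1 = card ?S" "card S2 = card ?S"
      unfolding S1_def S2_def by (rule card_image[OF inj1], rule card_image[OF inj2])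
    thus ?thesis
      unfolding bin card_Un_disjoint[OF fin disj] using cardS by (simp only: of_nat_add mult_2)
  qed
  have "{1} \<in> ?S" using N by auto
  hence ne: "binary_elements N \<noteq> {}" unfolding bin S1_def by blast
  have sum1: "(\<Sum>\<beta>\<in>S1. log_norm N \<beta>) = real (N - 1) * T"
  proof -
    have "(\<Sum>\<beta>\<in>S1. log_norm N \<beta>) = (\<Sum>A\<in>?S. log_norm N (zeta_sum N A))"
      unfolding S1_def by (simp only: sum.reindex[OF inj1] o_def)
    also have "\<dots> = (\<Sum>A\<in>?S. \<Sum>j=1..N-1. ln (norm (zeta_sum N ((\<lambda>i. j * i mod N) ` A))))"
      by (intro sum.cong refl log_norm_zeta_sum(1)[OF assms])
    also have "\<dots> = (\<Sum>j=1..N-1. \<Sum>A\<in>?S. ln (norm (zeta_sum N ((\<lambda>i. j * i mod N) ` A))))"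
      by (rule sum.swap)
    \<comment> \<open>Multiplication of exponents by \<open>j\<close> permutes the nonempty subsets,
      so every conjugate contributes the same total.\<close>
    also have "\<dots> = (\<Sum>j=1..N-1. T)"
      unfolding T_def
      by (intro sum.cong refl sum.reindex_bij_betw[where g = "\<lambda>A. ln (norm (zeta_sum N A))"]
          bij_betw_image_nonempty_Pow bij_betw_mult_mod_prime[OF assms(1)])
    finally show ?thesis by simp
  qed
  have "(\<Sum>\<beta>\<in>S2. log_norm N \<beta>) = (\<Sum>A\<in>?S. log_norm N (- zeta_sum N A))"
    unfolding S2_def by (simp only: sum.reindex[OF inj2] o_def)
  also have "\<dots> = (\<Sum>A\<in>?S. log_norm N (zeta_sum N A))"
    by (intro sum.cong refl log_norm_zeta_sum(2)[OF assms])
  also have "\<dots> = (\<Sum>\<beta>\<in>S1. log_norm N \<beta>)"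
    unfolding S1_def by (simp only: sum.reindex[OF inj1] o_def)
  finally have sum2: "(\<Sum>\<beta>\<in>S2. log_norm N \<beta>) = real (N - 1) * T" using sum1 by simp
  have "expected_log_norm N = (\<Sum>\<beta>\<in>binary_elements N. log_norm N \<beta>) / real (card (binary_elements N))"
    unfolding expected_log_norm_def by (rule integral_pmf_of_set[OF ne]) (simp add: bin fin)
  also have "(\<Sum>\<beta>\<in>binary_elements N. log_norm N \<beta>) = 2 * (real (N - 1) * T)"
    unfolding bin using sum1 sum2 by (simp add: sum.union_disjoint[OF fin disj])
  finally have "expected_log_norm N = 2 * (real (N - 1) * T) / (2 * (2 ^ (N - 1) - 1))"
    unfolding card .
  thus ?thesis
    by (simp only: mult_divide_mult_cancel_left_if T_def) simp
qed

text \<open>The quotient of powers of 2 reconciles two normalisations: the expectation averages over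
  nonempty subsets, while \<open>mean_log_square\<close> divides by the number of all
  subsets.\<close>

lemma expected_log_norm_eq_mean_log_square:
  assumes "prime N" "odd N"
  shows "expected_log_norm N =
    real (N - 1) / 2 * (ln (real N / 4) + mean_log_square N * (2 ^ (N - 1) / (2 ^ (N - 1) - 1)))"
proof -
  let ?S = "Pow {1..N-1} - {{}}"
  have N: "N > 1" using assms(1) prime_gt_1_nat by blast
  define M where "M = (2 :: real) ^ (N - 1)"
  have "(2 :: real) ^ 1 \<le> 2 ^ (N - 1)" using N by (intro power_increasing) auto
  hence M: "M > 1" by (simp add: M_def)
  have cardS: "real (card ?S) = M - 1"
    by (subst card_Diff_singleton) (auto simp: card_Pow of_nat_diff M_def)
  have ln: "ln (norm (zeta_sum N A)) = (ln (real N / 4) + ln ((norm (normalised_sum N A))\<^sup>2)) / 2" if "A \<in> ?S" for A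
  proof -
    define x where "x = norm (zeta_sum N A)"
    have x: "x > 0" using zeta_sum_eq_0_iff[OF assms(1), of A] that by (auto simp: x_def)
    have "(norm (normalised_sum N A))\<^sup>2 = x\<^sup>2 / (real N / 4)"
      by (simp add: normalised_sum_def x_def zeta_sum_def power_mult_distrib power_divide)
    also have "ln (x\<^sup>2 / (real N / 4)) = ln (x\<^sup>2) - ln (real N / 4)"
      using x N by (subst ln_div) auto
    finally have "ln ((norm (normalised_sum N A))\<^sup>2) = 2 * ln x - ln (real N / 4)"
      using x by (simp add: ln_realpow)
    thus ?thesis by (simp add: x_def)
  qed
  have "(\<Sum>A\<in>?S. ln (norm (zeta_sum N A))) = (\<Sum>A\<in>?S. (ln (real N / 4) + ln ((norm (normalised_sum N A))\<^sup>2)) / 2)"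
    by (intro sum.cong refl ln)
  also have "\<dots> = ((M - 1) * ln (real N / 4) + M * mean_log_square N) / 2"
    using cardS M by (simp add: sum.distrib sum_divide_distrib[symmetric] mean_log_square_def M_def)
  finally have sum: "(\<Sum>A\<in>?S. ln (norm (zeta_sum N A))) =
      ((M - 1) * ln (real N / 4) + M * mean_log_square N) / 2" .
  show ?thesis
    unfolding expected_log_norm_eq[OF assms] sum M_def[symmetric] using M
    by (simp add: field_simps)
qed

theorem theorem3:
  "(\<lambda>N. expected_log_norm N - 1 / 2 * (ln (real N / 4) - euler_mascheroni) * real N)
     \<in> o[inf at_top (principal {N :: nat. prime N \<and> odd N})](\<lambda>N. real N)"
proof -
  define F where "F = inf at_top (principal {N :: nat. prime N \<and> odd N})"
  have F: "F \<le> sequentially" by (simp add: F_def)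
  have primes: "eventually (\<lambda>N. prime N \<and> odd N) F"
    unfolding F_def eventually_inf_principal by simp
  have mean: "(mean_log_square \<longlongrightarrow> - euler_mascheroni) F"
  proof (rule mean_log_square_tendsto[OF F])
    show "eventually (\<lambda>N. \<forall>A. A \<subseteq> {1..N-1} \<longrightarrow> A \<noteq> {} \<longrightarrow> 1 \<le> norm (\<Sum>i\<in>A. zeta N ^ i) * real N ^ N) F"
      using primes
      by eventually_elim (use norm_zeta_sum_lower_bound in \<open>simp add: zeta_sum_def\<close>)
  qed
  \<comment> \<open>\<open>g\<close> is the error divided by \<open>N\<close>; its last summand
    comes from the prefactor \<open>(N - 1) / 2\<close> standing where the claim has
    \<open>N / 2\<close>.\<close>
  define g where "g = (\<lambda>N. (real N - 1) / (2 * real N) *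
      (mean_log_square N * (2 ^ (N - 1) / (2 ^ (N - 1) - 1)) + euler_mascheroni)
      - (ln (real N / 4) - euler_mascheroni) / (2 * real N))"
  have lim1: "((\<lambda>N. (real N - 1) / (2 * real N)) \<longlongrightarrow> 1 / 2) F"
    by (rule tendsto_mono[OF F]) real_asymp
  have lim2: "((\<lambda>N. 2 ^ (N - 1) / (2 ^ (N - 1) - 1) :: real) \<longlongrightarrow> 1) F"
  proof (rule tendsto_mono[OF F])
    have "(\<lambda>n. 2 ^ n / (2 ^ n - 1) :: real) \<longlonglongrightarrow> 1" by real_asymp
    thus "(\<lambda>N. 2 ^ (N - 1) / (2 ^ (N - 1) - 1) :: real) \<longlonglongrightarrow> 1"
      by (rule filterlim_compose) (rule filterlim_minus_const_nat_at_top)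
  qed
  have lim3: "((\<lambda>N. (ln (real N / 4) - euler_mascheroni) / (2 * real N)) \<longlongrightarrow> 0) F"
    by (rule tendsto_mono[OF F]) real_asymp
  have "(g \<longlongrightarrow> 1 / 2 * (- euler_mascheroni * 1 + euler_mascheroni) - 0) F"
    unfolding g_def by (intro tendsto_intros lim1 lim2 lim3 mean)
  hence g: "(g \<longlongrightarrow> 0) F" by simp
  have eq: "eventually (\<lambda>N. g N =
      (expected_log_norm N - 1 / 2 * (ln (real N / 4) - euler_mascheroni) * real N) / real N) F"
    using primes
  proof eventually_elim
    case (elim N)
    hence N: "N > 1" using prime_gt_1_nat by blast
    show ?case
      unfolding expected_log_norm_eq_mean_log_square[OF conjunct1[OF elim] conjunct2[OF elim]] g_def
      using N by (simp add: of_nat_diff divide_simps) (simp add: algebra_simps)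
  qed
  have "eventually (\<lambda>N. real N \<noteq> 0) F"
    using primes by eventually_elim (auto dest: prime_gt_0_nat)
  thus ?thesis
    unfolding F_def[symmetric]
    by (rule smalloI_tendsto[rotated]) (use g eq tendsto_cong in force)
qed

end
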